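(* For any integer $k\ge 1$ there exists a $c(k)$ such that the following holds. If $G$ is a torsion-free group, $A\subset G$ is a finite subset which is not contained in a left coset of any cyclic subgroup, and $B\subset G$ is a finite subset with more than $c(k)$ elements, then $$|AB|>|A|+|B|+k.$$
   Context: Groups are written multiplicatively and need not be abelian. For finite subsets $A,B$ of a group $G$, $AB=\{ab:\ a\in A,\ b\in B\}$, and $|\cdot|$ denotes the cardinality of a finite set. A left coset of a subgroup $H$ of $G$ is a set of the form $gH$ with $g\in G$. *)

theory Defs
  imports "HOL-Algebra.Elementary_Groups"
begin

definition torsion_free_group :: "('a, 'm) monoid_scheme \<Rightarrow> bool" where
  "torsion_free_group G \<longleftrightarrow>
     group G \<and> (\<forall>x \<in> carrier G. \<forall>n::nat. n \<ge> 1 \<longrightarrow> x [^]\<^bsub>G\<^esub> n = \<one>\<^bsub>G\<^esub> \<longrightarrow> x = \<one>\<^bsub>G\<^esub>)"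

definition in_left_coset_of_cyclic :: "('a, 'm) monoid_scheme \<Rightarrow> 'a set \<Rightarrow> bool" where
  "in_left_coset_of_cyclic G A \<longleftrightarrow>
     (\<exists>H g. subgroup H G \<and> cyclic_group (G\<lparr>carrier := H\<rparr>) \<and> g \<in> carrier G \<and> A \<subseteq> g <#\<^bsub>G\<^esub> H)"

text \<open>
  The type argument names the type over which the groups range. HOL cannot quantify over types
  below an existential quantifier, so a number \<open>c\<close> obtained from
  \<open>\<exists>c. product_set_threshold TYPE('a) k c\<close> could depend on \<open>'a\<close>. To express a single bound for
  the groups over all types, one states in addition that every bound for the groups over
  \<^typ>\<open>nat\<close> is also a bound for the groups over \<open>'a\<close>.
\<close>

definition product_set_threshold :: "'a itself \<Rightarrow> nat \<Rightarrow> nat \<Rightarrow> bool" where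
  "product_set_threshold (_ :: 'a itself) k c \<longleftrightarrow>
     (\<forall>(G :: 'a monoid) A B.
        torsion_free_group G \<longrightarrow>
        A \<subseteq> carrier G \<longrightarrow> finite A \<longrightarrow> \<not> in_left_coset_of_cyclic G A \<longrightarrow>
        B \<subseteq> carrier G \<longrightarrow> finite B \<longrightarrow> card B > c \<longrightarrow>
        card (A <#>\<^bsub>G\<^esub> B) > card A + card B + k)"

end

(*
  Let n = k + 3. If |AB| <= |A| + |B| + k and |B| >= n, take a finite U with |U| >= n that minimises
  first |AU| - |U| and then |U|. By submodularity of X |-> |AX| (Hamidoune's isoperimetric method),
  |U \<inter> Ug| < n for g \<noteq> 1, so S = U U^{-1} is large: |S| >= t|U| - n t^2 for all t <= |U|.
  On the other hand A is almost invariant under S, hence |Ag - A| <= j (|U| + k) for g in S^j, and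
  then |S^j| <= 2|A| as long as j (|U| + k) <= |A|/2. As S^j grows at least linearly in an infinite
  group, |A| cancels and U turns out to have at most 192 n elements.

  If one factor is bounded and the other is huge, the same growth estimate shows that the bounded one
  lies in a coset of a cyclic subgroup: any two elements of S have a common nontrivial power of
  bounded exponent, which yields a central z in the group generated by S; if z has infinite index,
  the powers of S grow quadratically, and if it has finite index, the transfer shows that the group
  is cyclic. So either |A| is bounded and this applies to A directly, or it applies to U, and a
  progression U with |AU| <= |A| + |U| + k and |U| >= k + 3 forces A into one coset of its subgroup.
*)
theory Submission
  imports Defs "HOL-Algebra.Weak_Morphisms" "HOL-Library.Countable_Set"
begin

section \<open>Translates and product sets\<close>

context group
begin

lemma r_coset_eq_image: "A #> g = (\<lambda>a. a \<otimes> g) ` A"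
  by (auto simp: r_coset_def)

lemma card_r_coset: "A \<subseteq> carrier G \<Longrightarrow> g \<in> carrier G \<Longrightarrow> card (A #> g) = card A"
  unfolding r_coset_eq_image by (rule card_image) (auto simp: inj_on_def subset_iff)

lemma finite_r_coset: "finite A \<Longrightarrow> finite (A #> g)"
  by (simp add: r_coset_eq_image)

lemma mem_r_coset_iff:
  "A \<subseteq> carrier G \<Longrightarrow> g \<in> carrier G \<Longrightarrow> y \<in> carrier G \<Longrightarrow> y \<in> A #> g \<longleftrightarrow> y \<otimes> inv g \<in> A"
  unfolding r_coset_eq_image by (force simp: m_assoc image_iff inv_solve_right subset_iff)

lemma finite_set_mult: "finite A \<Longrightarrow> finite B \<Longrightarrow> finite (A <#> B)"
  by (simp add: set_mult_def)

lemma mem_set_mult: "a \<in> A \<Longrightarrow> b \<in> B \<Longrightarrow> a \<otimes> b \<in> A <#> B"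
  by (auto simp: set_mult_def)

lemma card_set_mult_ge_right:
  assumes "finite A" "finite B" "A \<subseteq> carrier G" "B \<subseteq> carrier G" "a \<in> A"
  shows "card B \<le> card (A <#> B)"
proof (rule card_inj_on_le)
  show "inj_on (\<lambda>b. a \<otimes> b) B"
    using assms by (auto simp: inj_on_def subset_iff)
qed (use assms in \<open>auto intro: finite_set_mult mem_set_mult\<close>)

lemma card_inv_image: "A \<subseteq> carrier G \<Longrightarrow> card (m_inv G ` A) = card A"
  by (rule card_image) (rule inj_on_subset[OF inv_inj])

lemma inv_image_set_mult:
  assumes "A \<subseteq> carrier G" "B \<subseteq> carrier G"
  shows "m_inv G ` (A <#> B) = (m_inv G ` B) <#> (m_inv G ` A)"
proof -
  have "inv (a \<otimes> b) = inv b \<otimes> inv a" if "a \<in> A" "b \<in> B" for a b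
    using that assms inv_mult_group by blast
  then show ?thesis
    by (auto simp: set_mult_def image_UN)
qed

text \<open>A point agh outside A either has ag in A, and then lies in Ah, or comes from a point of
  Ag outside A. So the displacement |Ag - A| is subadditive in g, like a word length.\<close>

lemma card_r_coset_mult_diff:
  assumes "finite A" "A \<subseteq> carrier G" "g \<in> carrier G" "h \<in> carrier G"
  shows "card ((A #> (g \<otimes> h)) - A) \<le> card ((A #> g) - A) + card ((A #> h) - A)"
proof -
  have sub: "(A #> g) - A \<subseteq> carrier G"
    using assms by (auto simp: r_coset_def)
  have "(A #> (g \<otimes> h)) - A \<subseteq> (((A #> g) - A) #> h) \<union> ((A #> h) - A)"
    using assms unfolding r_coset_eq_image by (auto simp: image_iff m_assoc[symmetric] subset_iff)
  then have "card ((A #> (g \<otimes> h)) - A) \<le> card ((((A #> g) - A) #> h) \<union> ((A #> h) - A))"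
    using assms by (intro card_mono) (auto intro: finite_r_coset)
  also have "\<dots> \<le> card (((A #> g) - A) #> h) + card ((A #> h) - A)"
    by (rule card_Un_le)
  finally show ?thesis
    using card_r_coset[OF sub assms(4)] by simp
qed

text \<open>Each pair \<open>(g, b)\<close> with \<open>b \<in> A \<inter> A g\<close> is recovered from the pair \<open>(b, b g\<^sup>-\<^sup>1)\<close> of elements
  of \<open>A\<close>.\<close>
lemma card_mult_card_minus_le:
  assumes "finite A" "A \<subseteq> carrier G" "finite X" "X \<subseteq> carrier G"
    and D: "\<And>g. g \<in> X \<Longrightarrow> card ((A #> g) - A) \<le> D"
  shows "card X * (card A - D) \<le> card A * card A"
proof -
  let ?P = "Sigma X (\<lambda>g. A \<inter> (A #> g))"
  have "card A - D \<le> card (A \<inter> (A #> g))" if "g \<in> X" for g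
  proof -
    have "card (A #> g) = card ((A #> g) - A) + card (A \<inter> (A #> g))"
      using card_Int_Diff[of "A #> g" A] assms finite_r_coset by (simp add: Int_commute)
    moreover have "card (A #> g) = card A"
      using assms(2,4) that by (intro card_r_coset) auto
    ultimately show ?thesis
      using D[OF that] by linarith
  qed
  then have "card X * (card A - D) \<le> (\<Sum>g\<in>X. card (A \<inter> (A #> g)))"
    using sum_mono[of X "\<lambda>_. card A - D" "\<lambda>g. card (A \<inter> (A #> g))"] by simp
  also have "\<dots> = card ?P"
    using assms by simp
  also have "\<dots> \<le> card (A \<times> A)"
  proof (rule card_inj_on_le)
    show "inj_on (\<lambda>(g, b). (b, b \<otimes> inv g)) ?P"
      using assms by (auto simp: inj_on_def subset_iff inj_on_eq_iff[OF inv_inj])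
    show "(\<lambda>(g, b). (b, b \<otimes> inv g)) ` ?P \<subseteq> A \<times> A"
      using assms by (auto simp: r_coset_eq_image subset_iff m_assoc)
  qed (use assms in auto)
  finally show ?thesis
    by (simp add: card_cartesian_product)
qed

text \<open>For g = u v^-1 the set Ag - A is a translate of Au - Av. Both Au and Av lie in AU, and
  Av already fills |A| of its at most |A| + s elements.\<close>

lemma card_r_coset_quotient_diff:
  assumes "finite A" "A \<subseteq> carrier G" "finite U" "U \<subseteq> carrier G"
    and "card (A <#> U) \<le> card A + s" and "g \<in> U <#> (m_inv G ` U)"
  shows "card ((A #> g) - A) \<le> s"
proof -
  obtain u v where uv: "u \<in> U" "v \<in> U" "g = u \<otimes> inv v"
    using assms(6) by (auto simp: set_mult_def)
  have c: "u \<in> carrier G" "v \<in> carrier G"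
    using uv assms by auto
  have "(A #> g) - A = ((A #> u) - (A #> v)) #> inv v"
  proof (intro equalityI subsetI)
    fix y assume "y \<in> (A #> g) - A"
    then obtain a where a: "a \<in> A" "y = a \<otimes> u \<otimes> inv v" "y \<notin> A"
      using uv c assms(2) by (auto simp: r_coset_eq_image m_assoc)
    then have "a \<otimes> u \<notin> A #> v"
      using c assms(2) by (subst mem_r_coset_iff) auto
    with a show "y \<in> ((A #> u) - (A #> v)) #> inv v"
      by (auto simp: r_coset_eq_image)
  next
    fix y assume "y \<in> ((A #> u) - (A #> v)) #> inv v"
    then obtain a where a: "a \<in> A" "y = a \<otimes> u \<otimes> inv v" "a \<otimes> u \<notin> A #> v"
      by (auto simp: r_coset_eq_image)
    then have "y \<notin> A"
      using c assms(2) mem_r_coset_iff[of A v "a \<otimes> u"] by auto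
    moreover have "y \<in> A #> g"
      using a uv c assms(2) by (auto simp: r_coset_eq_image m_assoc)
    ultimately show "y \<in> (A #> g) - A" by simp
  qed
  then have "card ((A #> g) - A) = card ((A #> u) - (A #> v))"
    using c assms by (simp, subst card_r_coset) (auto simp: r_coset_eq_image)
  also have "\<dots> \<le> card ((A <#> U) - (A #> v))"
    using uv assms by (intro card_mono) (auto simp: r_coset_eq_image intro: finite_set_mult mem_set_mult)
  also have "\<dots> = card (A <#> U) - card (A #> v)"
    using uv assms by (intro card_Diff_subset) (auto simp: r_coset_eq_image intro: mem_set_mult)
  also have "\<dots> \<le> s"
    using assms c card_r_coset[of A v] by simp
  finally show ?thesis .
qed

end

section \<open>Powers of a set\<close>

primrec set_pow :: "('a, 'm) monoid_scheme \<Rightarrow> 'a set \<Rightarrow> nat \<Rightarrow> 'a set" where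
  "set_pow G S 0 = {\<one>\<^bsub>G\<^esub>}"
| "set_pow G S (Suc n) = set_pow G S n <#>\<^bsub>G\<^esub> S"

context group
begin

lemma set_pow_subset: "S \<subseteq> carrier G \<Longrightarrow> set_pow G S n \<subseteq> carrier G"
  by (induction n) (auto simp: set_mult_def)

lemma finite_set_pow: "finite S \<Longrightarrow> finite (set_pow G S n)"
  by (induction n) (auto intro: finite_set_mult)

lemma set_pow_add:
  assumes "S \<subseteq> carrier G"
  shows "set_pow G S (m + n) = set_pow G S m <#> set_pow G S n"
proof (induction n)
  case 0
  then show ?case
    using set_pow_subset[OF assms, of m] by (force simp: set_mult_def subset_iff)
next
  case (Suc n)
  then show ?case
    using assms by (simp add: set_mult_assoc set_pow_subset)
qed

lemma mem_set_pow_add: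
  "S \<subseteq> carrier G \<Longrightarrow> x \<in> set_pow G S m \<Longrightarrow> y \<in> set_pow G S n \<Longrightarrow> x \<otimes> y \<in> set_pow G S (m + n)"
  by (simp add: set_pow_add mem_set_mult)

lemma set_pow_Suc_mono:
  assumes "S \<subseteq> carrier G" "\<one> \<in> S"
  shows "set_pow G S n \<subseteq> set_pow G S (Suc n)"
proof
  fix x assume x: "x \<in> set_pow G S n"
  then have "x \<otimes> \<one> \<in> set_pow G S (Suc n)"
    unfolding set_pow.simps using assms by (intro mem_set_mult)
  then show "x \<in> set_pow G S (Suc n)"
    using x set_pow_subset[OF assms(1), of n] by (auto simp: subset_iff)
qed

lemma set_pow_mono:
  assumes "S \<subseteq> carrier G" "\<one> \<in> S" "m \<le> n"
  shows "set_pow G S m \<subseteq> set_pow G S n"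
  using lift_Suc_mono_le[of "set_pow G S"] set_pow_Suc_mono assms by blast

lemma nat_pow_mem_set_pow:
  assumes "S \<subseteq> carrier G" "x \<in> set_pow G S m"
  shows "x [^] (n::nat) \<in> set_pow G S (n * m)"
proof (induction n)
  case (Suc n)
  then have "x [^] n \<otimes> x \<in> set_pow G S (n * m + m)"
    using assms by (intro mem_set_pow_add)
  then show ?case
    by (simp add: add.commute)
qed simp

lemma mem_set_pow_1: "S \<subseteq> carrier G \<Longrightarrow> x \<in> S \<Longrightarrow> x \<in> set_pow G S 1"
  by (force simp: set_mult_def)

lemma inv_mem_set_pow:
  assumes S: "S \<subseteq> carrier G" "m_inv G ` S \<subseteq> S" and "x \<in> set_pow G S n"
  shows "inv x \<in> set_pow G S n"
  using assms(3)
proof (induction n arbitrary: x)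
  case (Suc n)
  then obtain y s where ys: "y \<in> set_pow G S n" "s \<in> S" "x = y \<otimes> s"
    by (auto simp: set_mult_def)
  then have "inv x = inv s \<otimes> inv y"
    using S set_pow_subset[OF S(1), of n] by (auto simp: inv_mult_group subset_iff)
  moreover have "inv s \<in> set_pow G S 1"
    using S ys by (intro mem_set_pow_1) auto
  ultimately show ?case
    using mem_set_pow_add[OF S(1), of "inv s" 1 "inv y" n] Suc.IH[OF ys(1)] by simp
qed simp

lemma card_r_coset_set_pow_diff:
  assumes "finite A" "A \<subseteq> carrier G" "S \<subseteq> carrier G"
    and s: "\<And>g. g \<in> S \<Longrightarrow> card ((A #> g) - A) \<le> s"
    and "g \<in> set_pow G S n"
  shows "card ((A #> g) - A) \<le> n * s"
  using assms(5)
proof (induction n arbitrary: g)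
  case 0
  then show ?case
    using assms by simp
next
  case (Suc n)
  then obtain x y where xy: "x \<in> set_pow G S n" "y \<in> S" "g = x \<otimes> y"
    by (auto simp: set_mult_def)
  then have "x \<in> carrier G" "y \<in> carrier G"
    using assms set_pow_subset[of S n] by auto
  then have "card ((A #> g) - A) \<le> card ((A #> x) - A) + card ((A #> y) - A)"
    using xy card_r_coset_mult_diff assms by simp
  also have "\<dots> \<le> n * s + s"
    using Suc.IH s xy by (intro add_mono) auto
  finally show ?case
    by (simp add: add.commute)
qed

text \<open>By subadditivity an element of S^n displaces at most ns <= |A|/2 points of A, so at
  least half of the points stay in A, and counting pairs gives |S^n| |A|/2 <= |A|^2.\<close>

lemma card_set_pow_mult_le:
  assumes "finite A" "A \<subseteq> carrier G" "finite S" "S \<subseteq> carrier G"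
    and "\<And>g. g \<in> S \<Longrightarrow> card ((A #> g) - A) \<le> s"
    and "2 * (n * s) \<le> card A" "A \<noteq> {}"
  shows "card (set_pow G S n) \<le> 2 * card A"
proof -
  have "card (set_pow G S n) * (card A - n * s) \<le> card A * card A"
    using assms by (intro card_mult_card_minus_le card_r_coset_set_pow_diff)
      (auto intro: finite_set_pow set_pow_subset[THEN subsetD])
  moreover have "card (set_pow G S n) * card A \<le> card (set_pow G S n) * (2 * (card A - n * s))"
    using assms by (intro mult_left_mono) auto
  ultimately have "card (set_pow G S n) * card A \<le> 2 * card A * card A"
    by linarith
  moreover have "card A > 0"
    using assms by (simp add: card_gt_0_iff)
  ultimately show ?thesis
    by simp
qed

end

section \<open>Sets with small intersections with their translates\<close>

lemma card_le_mult_card_fibres: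
  assumes "finite T" "finite Y" "f ` T \<subseteq> Y"
    and "\<And>y. y \<in> Y \<Longrightarrow> card {t \<in> T. f t = y} \<le> n"
  shows "card T \<le> n * card Y"
proof -
  have "card T = (\<Sum>y\<in>Y. card {t \<in> T. f t = y})"
    using sum.group[OF assms(1-3), of "\<lambda>_. 1::nat"] by simp
  also have "\<dots> \<le> n * card Y"
    using sum_mono[of Y "\<lambda>y. card {t \<in> T. f t = y}" "\<lambda>_. n"] assms(4) by (simp add: mult.commute)
  finally show ?thesis .
qed

context group
begin

text \<open>Collects for S = U U^-1 what the growth lemmas ask of a generating set: finite,
  symmetric, containing 1, with an explicit nontrivial element.\<close>

lemma quotient_set_closed:
  assumes "finite U" "U \<subseteq> carrier G" "u \<in> U" "v \<in> U" "u \<noteq> v"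
  defines "S \<equiv> U <#> (m_inv G ` U)"
  shows "finite S" "S \<subseteq> carrier G" "\<one> \<in> S" "m_inv G ` S \<subseteq> S" "u \<otimes> inv v \<in> S" "u \<otimes> inv v \<noteq> \<one>"
proof -
  have cU: "u \<in> carrier G" if "u \<in> U" for u using that assms by blast
  show "finite S" unfolding S_def using assms by (intro finite_set_mult) auto
  show "S \<subseteq> carrier G" unfolding S_def using cU by (intro set_mult_closed) auto
  have "u \<otimes> inv u \<in> S" unfolding S_def using assms by (intro mem_set_mult) auto
  then show "\<one> \<in> S" using assms cU by simp
  show "m_inv G ` S \<subseteq> S"
    unfolding S_def using assms cU by (subst inv_image_set_mult) (auto simp: image_image)
  show "u \<otimes> inv v \<in> S" "u \<otimes> inv v \<noteq> \<one>"
    using assms cU by (auto simp: S_def mem_set_mult inv_solve_right')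
qed

text \<open>Double counting of the pairs (au, av) with u and v distinct. Such a pair determines g =
  v^-1 u, which is not 1; then u lies in both U and Ug, and u determines a and v. So each pair
  arises at most n times.\<close>

lemma card_set_mult_squared_ge:
  assumes "finite A" "A \<subseteq> carrier G" "finite U" "U \<subseteq> carrier G"
    and n: "\<And>g. g \<in> carrier G \<Longrightarrow> g \<noteq> \<one> \<Longrightarrow> card (U \<inter> (U #> g)) \<le> n"
  shows "card A * (card U * (card U - 1)) \<le> n * (card (A <#> U) * card (A <#> U))"
proof -
  define T where "T = A \<times> (U \<times> U - Id_on U)"
  define f where "f = (\<lambda>(a, u, v). (a \<otimes> u, a \<otimes> v))"
  have cU: "x \<in> carrier G" if "x \<in> U" for x using that assms by auto
  have cA: "x \<in> carrier G" if "x \<in> A" for x using that assms by auto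
  have "card (U \<times> U - Id_on U) = card U * card U - card U"
  proof -
    have "Id_on U = (\<lambda>x. (x, x)) ` U" by (auto simp: Id_on_def)
    then have "card (Id_on U) = card U" by (simp add: card_image inj_on_def)
    then show ?thesis
      using assms by (subst card_Diff_subset) (auto simp: card_cartesian_product Id_on_def)
  qed
  then have cardT: "card T = card A * (card U * (card U - 1))"
    by (simp add: T_def card_cartesian_product diff_mult_distrib2)
  have "card T \<le> n * card ((A <#> U) \<times> (A <#> U))"
  proof (rule card_le_mult_card_fibres[of _ _ f])
    show "finite T" "finite ((A <#> U) \<times> (A <#> U))"
      using assms by (auto simp: T_def intro: finite_set_mult)
    show "f ` T \<subseteq> (A <#> U) \<times> (A <#> U)"
      by (auto simp: T_def f_def intro: mem_set_mult)
  next
    fix y assume "y \<in> (A <#> U) \<times> (A <#> U)"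
    then obtain y1 y2 where y: "y = (y1, y2)" "y1 \<in> carrier G" "y2 \<in> carrier G"
      using set_mult_closed[OF assms(2,4)] by auto
    define g where "g = inv y2 \<otimes> y1"
    have gc: "g \<in> carrier G" using y by (simp add: g_def)
    show "card {t \<in> T. f t = y} \<le> n"
    proof (cases "g = \<one>")
      case True
      then have "y1 = y2"
        using y by (metis g_def inv_closed inv_equality inv_inv)
      then have "{t \<in> T. f t = y} = {}"
        using y cU cA by (auto simp: T_def f_def)
      then show ?thesis by (simp only: card.empty)
    next
      case False
      have g: "g = inv v \<otimes> u" "u = v \<otimes> g" if "a \<in> A" "u \<in> U" "v \<in> U" "a \<otimes> u = y1" "a \<otimes> v = y2" for a u v
        using that cU cA by (auto simp: g_def inv_mult_group m_assoc inv_solve_left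
            simp flip: m_assoc[of "inv a" a u] m_assoc[of v "inv v" u])
      have "card {t \<in> T. f t = y} \<le> card (U \<inter> (U #> g))"
      proof (rule card_inj_on_le)
        show "inj_on (\<lambda>(a, u, v). u) {t \<in> T. f t = y}"
          using y cU cA by (auto simp: inj_on_def T_def f_def)
        show "(\<lambda>(a, u, v). u) ` {t \<in> T. f t = y} \<subseteq> U \<inter> (U #> g)"
          using y g(2) by (auto simp: T_def f_def r_coset_eq_image)
      qed (use assms in auto)
      also have "\<dots> \<le> n"
        using n gc False by simp
      finally show ?thesis .
    qed
  qed
  then show ?thesis
    by (simp add: cardT card_cartesian_product)
qed

text \<open>Crude inclusion-exclusion: the translates U w^-1 for w in V have |U| elements each and
  meet pairwise in at most n elements, so a new translate contributes at least |U| - n|V|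
  elements.\<close>

lemma card_quotient_set_ge_aux:
  assumes "finite U" "U \<subseteq> carrier G" "finite V" "V \<subseteq> carrier G"
    and n: "\<And>g. g \<in> carrier G \<Longrightarrow> g \<noteq> \<one> \<Longrightarrow> card (U \<inter> (U #> g)) \<le> n"
  shows "card V * card U \<le> card (U <#> (m_inv G ` V)) + n * (card V * card V)"
  using assms(3,4)
proof (induction V)
  case empty
  then show ?case by simp
next
  case (insert v V)
  let ?X = "U <#> (m_inv G ` V)"
  have cV: "w \<in> carrier G" if "w \<in> V" for w using that insert by auto
  have v: "v \<in> carrier G" using insert by auto
  have fin: "finite ?X" using assms insert by (intro finite_set_mult) auto
  have eq: "U <#> (m_inv G ` insert v V) = ?X \<union> (U #> inv v)"
    by (auto simp: set_mult_def r_coset_def)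
  have "card ((U #> inv w) \<inter> (U #> inv v)) \<le> n" if "w \<in> V" for w
  proof -
    let ?g = "inv v \<otimes> w"
    have w: "w \<in> carrier G" "w \<noteq> v" using that cV insert by auto
    have "(U #> inv w) \<inter> (U #> inv v) \<subseteq> (U \<inter> (U #> ?g)) #> inv w"
    proof
      fix y assume "y \<in> (U #> inv w) \<inter> (U #> inv v)"
      then obtain u u' where u: "u \<in> U" "u' \<in> U" "y = u \<otimes> inv w" "y = u' \<otimes> inv v"
        by (auto simp: r_coset_eq_image)
      then have c: "u \<in> carrier G" "u' \<in> carrier G" using assms by auto
      have "u = y \<otimes> w" using u c w by (simp add: m_assoc)
      also have "\<dots> = u' \<otimes> ?g" unfolding u(4) using c v w by (simp add: m_assoc)
      finally show "y \<in> (U \<inter> (U #> ?g)) #> inv w"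
        using u by (auto simp: r_coset_eq_image)
    qed
    then have "card ((U #> inv w) \<inter> (U #> inv v)) \<le> card ((U \<inter> (U #> ?g)) #> inv w)"
      using assms by (intro card_mono) (auto intro: finite_r_coset)
    also have "\<dots> = card (U \<inter> (U #> ?g))"
      using assms w by (intro card_r_coset) auto
    also have "\<dots> \<le> n"
      using v w by (intro n) (auto simp: inv_solve_left')
    finally show ?thesis .
  qed
  then have "(\<Sum>w\<in>V. card ((U #> inv w) \<inter> (U #> inv v))) \<le> card V * n"
    using sum_bounded_above[of V "\<lambda>w. card ((U #> inv w) \<inter> (U #> inv v))" n] by simp
  moreover have "?X \<inter> (U #> inv v) = (\<Union>w\<in>V. (U #> inv w) \<inter> (U #> inv v))"
    by (auto simp: set_mult_def r_coset_def)
  ultimately have "card (?X \<inter> (U #> inv v)) \<le> card V * n"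
    using card_UN_le[OF insert(1), of "\<lambda>w. (U #> inv w) \<inter> (U #> inv v)"] by simp
  moreover have "card ?X + card (U #> inv v) = card (?X \<union> (U #> inv v)) + card (?X \<inter> (U #> inv v))"
    using assms fin by (intro card_Un_Int) (auto intro: finite_r_coset)
  moreover have "card (U #> inv v) = card U"
    using assms v by (intro card_r_coset) auto
  moreover have "card V * card U \<le> card ?X + n * (card V * card V)"
    using insert by simp
  ultimately have "card V * card U + card U \<le> card (?X \<union> (U #> inv v)) + n * (card V * card V) + card V * n"
    by linarith
  then show ?case
    unfolding eq using insert by (simp add: algebra_simps)
qed

text \<open>Only t elements of the second factor are used, so that the error term n t^2 does not
  grow with |U|.\<close>

lemma card_quotient_set_ge:
  assumes "finite U" "U \<subseteq> carrier G" "t \<le> card U"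
    and n: "\<And>g. g \<in> carrier G \<Longrightarrow> g \<noteq> \<one> \<Longrightarrow> card (U \<inter> (U #> g)) \<le> n"
  shows "t * card U \<le> card (U <#> (m_inv G ` U)) + n * (t * t)"
proof -
  obtain V where V: "V \<subseteq> U" "card V = t" "finite V"
    using obtain_subset_with_card_n[OF assms(3)] assms(1) finite_subset by metis
  have "card (U <#> (m_inv G ` V)) \<le> card (U <#> (m_inv G ` U))"
    using assms V by (intro card_mono finite_set_mult mono_set_mult) auto
  then show ?thesis
    using card_quotient_set_ge_aux[OF assms(1,2) V(3) subset_trans[OF V(1) assms(2)] n] V(2) by simp
qed

end

section \<open>Torsion-free groups\<close>

locale torsion_free = group G for G (structure) +
  assumes torsion_free: "x \<in> carrier G \<Longrightarrow> n \<ge> 1 \<Longrightarrow> x [^] (n::nat) = \<one> \<Longrightarrow> x = \<one>"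
begin

lemma int_pow_eq_iff:
  assumes "x \<in> carrier G" "x \<noteq> \<one>"
  shows "x [^] (i::int) = x [^] j \<longleftrightarrow> i = j"
proof
  have *: "i \<le> j" if "x [^] i = x [^] j" for i j :: int
  proof (rule ccontr)
    assume "\<not> i \<le> j"
    then obtain n where n: "i - j = int n" "n \<ge> 1"
      by (metis zero_less_imp_eq_int diff_gt_0_iff_gt not_le Suc_leI One_nat_def)
    have "x [^] n = x [^] (i - j)"
      by (simp add: n int_pow_int)
    also have "\<dots> = \<one>"
      using that assms by (simp add: int_pow_diff)
    finally show False
      using torsion_free n assms by blast
  qed
  show "x [^] i = x [^] j \<Longrightarrow> i = j"
    using * by (simp add: order_antisym)
qed simp

text \<open>A nonempty finite set stable under right multiplication by x would contain all elements
  a x^n, which are distinct because x has infinite order.\<close>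

lemma ex_mult_notin:
  assumes "finite X" "X \<noteq> {}" "X \<subseteq> carrier G" "x \<in> carrier G" "x \<noteq> \<one>"
  shows "\<exists>a\<in>X. a \<otimes> x \<notin> X"
proof (rule ccontr)
  assume "\<not> ?thesis"
  then have cl: "a \<otimes> x \<in> X" if "a \<in> X" for a using that by blast
  obtain a where a: "a \<in> X" using assms by blast
  then have ac: "a \<in> carrier G" using assms by blast
  have "a \<otimes> x [^] n \<in> X" for n :: nat
    by (induction n) (use a ac assms cl in \<open>auto simp flip: m_assoc\<close>)
  moreover have "inj (\<lambda>n::nat. a \<otimes> x [^] n)"
    using ac assms int_pow_eq_iff[of x "int _" "int _"] by (auto simp: inj_def int_pow_int)
  ultimately show False
    using finite_subset[of "range (\<lambda>n::nat. a \<otimes> x [^] n)" X] assms(1) range_inj_infinite by blast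
qed

text \<open>Packing translates of S: take g in S^(3m+3) outside S^(3m+2). By symmetry of S, gS
  misses S^(3m+1), since gs in S^(3m+1) would put g into S^(3m+2). As gS lies in S^(3m+4), three
  more factors add |S| new elements.\<close>

lemma card_set_pow_ge:
  assumes S: "finite S" "S \<subseteq> carrier G" "\<one> \<in> S" "m_inv G ` S \<subseteq> S" and x: "x \<in> S" "x \<noteq> \<one>"
  shows "(m + 1) * card S \<le> card (set_pow G S (3 * m + 1))"
proof (induction m)
  case 0
  have "S \<subseteq> set_pow G S 1"
    using mem_set_pow_1[OF S(2)] by blast
  then show ?case
    using card_mono[OF finite_set_pow[OF S(1), of 1]] by simp
next
  case (Suc m)
  have "set_pow G S (3 * m + 2) \<noteq> {}"
    using set_pow_mono[OF S(2,3), of 0 "3 * m + 2"] by auto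
  then obtain a where a: "a \<in> set_pow G S (3 * m + 2)" "a \<otimes> x \<notin> set_pow G S (3 * m + 2)"
    using ex_mult_notin[of "set_pow G S (3 * m + 2)" x] S x finite_set_pow set_pow_subset by blast
  define g where "g = a \<otimes> x"
  have g: "g \<in> set_pow G S (3 * m + 3)"
    using mem_set_pow_add[OF S(2) a(1) mem_set_pow_1[OF S(2) x(1)]]
    by (simp add: g_def numeral_eq_Suc)
  have gc: "g \<in> carrier G" using set_pow_subset[OF S(2)] g by blast
  have sc: "s \<in> carrier G" if "s \<in> S" for s using that S by blast
  let ?Y = "(\<lambda>s. g \<otimes> s) ` S"
  have "g \<otimes> s \<notin> set_pow G S (3 * m + 1)" if "s \<in> S" for s
  proof
    assume "g \<otimes> s \<in> set_pow G S (3 * m + 1)"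
    moreover have "inv s \<in> set_pow G S 1"
      using that S by (intro mem_set_pow_1) auto
    ultimately have "g \<otimes> s \<otimes> inv s \<in> set_pow G S (3 * m + 1 + 1)"
      by (rule mem_set_pow_add[OF S(2)])
    then show False
      using a gc sc[OF that] by (simp add: m_assoc g_def numeral_eq_Suc)
  qed
  then have disj: "set_pow G S (3 * m + 1) \<inter> ?Y = {}" by blast
  have "set_pow G S (3 * m + 1) \<union> ?Y \<subseteq> set_pow G S (3 * Suc m + 1)"
  proof -
    have "?Y \<subseteq> set_pow G S (3 * m + 3 + 1)"
      using mem_set_pow_add[OF S(2) g mem_set_pow_1[OF S(2)]] by blast
    moreover have "set_pow G S (3 * m + 1) \<subseteq> set_pow G S (3 * Suc m + 1)"
      by (intro set_pow_mono S) simp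
    ultimately show ?thesis by (simp add: add.commute)
  qed
  then have "card (set_pow G S (3 * m + 1) \<union> ?Y) \<le> card (set_pow G S (3 * Suc m + 1))"
    by (intro card_mono finite_set_pow S)
  moreover have "card ?Y = card S"
    using gc sc by (intro card_image) (auto simp: inj_on_def)
  moreover have "card (set_pow G S (3 * m + 1) \<union> ?Y) = card (set_pow G S (3 * m + 1)) + card ?Y"
    using S disj by (intro card_Un_disjoint finite_set_pow) auto
  ultimately show ?case
    using Suc by (simp only: add_mult_distrib mult_1 Suc_eq_plus1)
qed

lemma mult_card_le_card_set_pow:
  assumes S: "finite S" "S \<subseteq> carrier G" "\<one> \<in> S" "m_inv G ` S \<subseteq> S" and x: "x \<in> S" "x \<noteq> \<one>"
  shows "n * card S \<le> 3 * card (set_pow G S n)"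
proof (cases "n = 0")
  case False
  \<comment> \<open>The largest m with 3m + 1 <= n; rounding n up to 3(m + 1) costs the factor
    3.\<close>
  define m where "m = (n - 1) div 3"
  have m: "3 * m + 1 \<le> n" "n \<le> 3 * (m + 1)"
    using False by (auto simp: m_def)
  have "n * card S \<le> 3 * ((m + 1) * card S)"
    using m(2) mult_le_mono1[of n "3 * (m + 1)" "card S"] by (simp only: mult.assoc)
  also have "\<dots> \<le> 3 * card (set_pow G S (3 * m + 1))"
    using card_set_pow_ge[OF assms, of m] by simp
  also have "\<dots> \<le> 3 * card (set_pow G S n)"
    using m(1) by (intro mult_le_mono2 card_mono finite_set_pow set_pow_mono S)
  finally show ?thesis .
qed simp

section \<open>Atoms\<close>

text \<open>Suppose V = Ug meets U in at least n elements. Then intersection and union both compete,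
  so each has excess |AX| - |X| at least the minimum d. As X |-> |AX| is submodular and U and V have
  excess d, the intersection has excess exactly d although it is smaller than U. Since B competes
  too, d <= s.\<close>

lemma ex_atom:
  assumes A: "finite A" "A \<subseteq> carrier G" "A \<noteq> {}"
    and B: "finite B" "B \<subseteq> carrier G" "n \<le> card B" "card (A <#> B) \<le> card B + s" and n: "n \<ge> 1"
  obtains U where "finite U" "U \<subseteq> carrier G" "n \<le> card U" "card (A <#> U) \<le> card U + s"
    "\<And>g. g \<in> carrier G \<Longrightarrow> g \<noteq> \<one> \<Longrightarrow> card (U \<inter> (U #> g)) < n"
proof -
  define P where "P X \<longleftrightarrow> finite X \<and> X \<subseteq> carrier G \<and> n \<le> card X" for X
  define Q where "Q d X \<longleftrightarrow> P X \<and> card (A <#> X) = card X + d" for d X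
  define d where "d = (LEAST d. \<exists>X. Q d X)"
  \<comment> \<open>\<open>A\<close> is nonempty, so the excess |AX| - |X| is not truncated in the
    naturals.\<close>
  have ge: "card X \<le> card (A <#> X)" if "P X" for X
    using A that card_set_mult_ge_right[of A X] by (auto simp: P_def)
  have Q: "Q (card (A <#> X) - card X) X" if "P X" for X
    using ge that by (auto simp: Q_def)
  have PB: "P B" using B by (simp add: P_def)
  have dX: "card X + d \<le> card (A <#> X)" if "P X" for X
  proof -
    have "d \<le> card (A <#> X) - card X"
      unfolding d_def using Q[OF that] by (intro Least_le) blast
    then show ?thesis using ge[OF that] by simp
  qed
  have "\<exists>X. Q d X"
    unfolding d_def by (rule LeastI_ex) (use Q[OF PB] in blast)
  then obtain U where U: "Q d U" "\<And>X. Q d X \<Longrightarrow> card U \<le> card X"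
    using ex_has_least_nat[of "Q d" _ card] by metis
  have PU: "finite U" "U \<subseteq> carrier G" "n \<le> card U" "card (A <#> U) = card U + d"
    using U by (auto simp: Q_def P_def)
  have "card (U \<inter> (U #> g)) < n" if g: "g \<in> carrier G" "g \<noteq> \<one>" for g
  proof (rule ccontr)
    let ?V = "U #> g"
    assume "\<not> card (U \<inter> ?V) < n"
    then have PI: "P (U \<inter> ?V)"
      using PU by (auto simp: P_def)
    have V: "finite ?V" "?V \<subseteq> carrier G" "card ?V = card U"
      using PU g by (simp_all add: finite_r_coset card_r_coset r_coset_subset_G)
    have "U \<noteq> {}"
      using PU(3) n by auto
    then have "\<exists>a\<in>U. a \<otimes> g \<notin> U"
      using PU g by (intro ex_mult_notin)
    \<comment> \<open>Ug has as many elements as U, so not being contained in U makes the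
      intersection strictly smaller.\<close>
    then have "U \<inter> ?V \<noteq> ?V" by (auto simp: r_coset_eq_image)
    then have lt: "card (U \<inter> ?V) < card U"
      using psubset_card_mono[OF V(1), of "U \<inter> ?V"] V(3) by auto
    then have "\<not> Q d (U \<inter> ?V)" using U(2) by fastforce
    then have 1: "card (U \<inter> ?V) + d < card (A <#> (U \<inter> ?V))"
      using dX[OF PI] PI by (auto simp: Q_def)
    have "P (U \<union> ?V)"
      using PU V card_mono[of "U \<union> ?V" U] by (auto simp: P_def)
    then have 2: "card (U \<union> ?V) + d \<le> card (A <#> (U \<union> ?V))"
      by (rule dX)
    have AV: "A <#> ?V = (A <#> U) #> g"
      using A PU g by (simp add: setmult_rcos_assoc)
    have "card (A <#> ?V) = card U + d"
      unfolding AV using PU A g by (subst card_r_coset) (auto simp: set_mult_closed)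
    moreover have "card (A <#> U) + card (A <#> ?V)
        = card ((A <#> U) \<union> (A <#> ?V)) + card ((A <#> U) \<inter> (A <#> ?V))"
      using A PU V by (intro card_Un_Int finite_set_mult) 
    moreover have "card ((A <#> U) \<union> (A <#> ?V)) = card (A <#> (U \<union> ?V))"
      by (rule arg_cong[of _ _ card]) (auto simp: set_mult_def)
    moreover have "card (A <#> (U \<inter> ?V)) \<le> card ((A <#> U) \<inter> (A <#> ?V))"
      using A PU V by (intro card_mono) (auto simp: set_mult_def)
    moreover have "card U + card ?V = card (U \<union> ?V) + card (U \<inter> ?V)"
      using PU V by (intro card_Un_Int)
    ultimately show False
      using 1 2 PU V by linarith
  qed
  then show thesis
    using that[of U] PU dX[OF PB] B by simp
qed

text \<open>Compares two bounds for S = U U^-1, whose elements displace at most s = |U| + k <= 2|U|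
  points of A. Slow growth relative to A gives |S| <= 24s <= 48|U|, and the small intersections give
  |S| >= 96|U| - 96^2 n; together |U| <= 192n.\<close>

lemma card_le_of_small_intersections:
  assumes A: "finite A" "A \<subseteq> carrier G" and U: "finite U" "U \<subseteq> carrier G" "2 \<le> card U"
    and AU: "card (A <#> U) \<le> card A + card U + k" and k: "k \<le> card U" and large: "72 * n < card A" and "n \<ge> 1"
    and n: "\<And>g. g \<in> carrier G \<Longrightarrow> g \<noteq> \<one> \<Longrightarrow> card (U \<inter> (U #> g)) \<le> n"
  shows "card U \<le> 192 * n"
proof (rule ccontr)
  assume big: "\<not> card U \<le> 192 * n"
  define s where "s = card U + k"
  have s: "s \<le> 2 * card U" "s > 0" using k U by (auto simp: s_def)
  define S where "S = U <#> (m_inv G ` U)"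
  obtain u v where uv: "u \<in> U" "v \<in> U" "u \<noteq> v"
    using U card_le_Suc0_iff_eq[OF U(1)] by force
  note S = quotient_set_closed(1-4)[OF U(1,2) uv, folded S_def]
    and x = quotient_set_closed(5,6)[OF U(1,2) uv, folded S_def]
  \<comment> \<open>Otherwise |A| < 2s <= 4|U| and |AU| <= 6|U|, so that counting pairs gives |A|
    (|U| - 1) <= 36n|U| <= 72n (|U| - 1).\<close>
  have "2 * s \<le> card A"
  proof (rule ccontr)
    assume "\<not> 2 * s \<le> card A"
    then have "card (A <#> U) \<le> 6 * card U"
      using AU s k by linarith
    then have "card (A <#> U) * card (A <#> U) \<le> (6 * card U) * (6 * card U)"
      by (intro mult_le_mono)
    then have "card A * (card U * (card U - 1)) \<le> n * ((6 * card U) * (6 * card U))"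
      using card_set_mult_squared_ge[OF A U(1,2) n] by (meson le_trans mult_le_mono2)
    also have "\<dots> \<le> n * ((6 * card U) * (12 * (card U - 1)))"
      using U(3) by (intro mult_le_mono2) simp
    also have "\<dots> = (72 * n) * (card U * (card U - 1))"
      by simp
    finally show False
      using large U(3) by (simp add: mult_le_cancel2)
  qed
  \<comment> \<open>The largest j with js <= |A|/2.\<close>
  define j where "j = card A div (2 * s)"
  have j: "j \<ge> 1" "2 * (j * s) \<le> card A" "card A < 2 * s * (j + 1)"
  proof -
    show "j \<ge> 1" using \<open>2 * s \<le> card A\<close> s by (simp add: j_def div_greater_zero_iff Suc_le_eq)
    show "2 * (j * s) \<le> card A" unfolding j_def by (metis div_times_less_eq_dividend mult.assoc mult.commute)
    show "card A < 2 * s * (j + 1)" unfolding j_def using s dividend_less_times_div[of "2 * s" "card A"] by simp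
  qed
  have "card (set_pow G S j) \<le> 2 * card A"
  proof (rule card_set_pow_mult_le[OF A S(1,2)])
    show "card ((A #> g) - A) \<le> s" if "g \<in> S" for g
      using card_r_coset_quotient_diff[OF A U(1,2)] AU that by (simp add: S_def s_def)
  qed (use j large in auto)
  then have "j * card S \<le> 6 * card A"
    using mult_card_le_card_set_pow[OF S x, of j] by linarith
  also have "\<dots> \<le> 6 * (2 * s * (j + 1))" using j(3) by simp
  also have "\<dots> \<le> j * (24 * s)" using j(1) by (simp add: algebra_simps)
  finally have "card S \<le> 24 * s" using j(1) by simp
  \<comment> \<open>Here t = 96 is twice the 48 of the upper bound |S| <= 48|U|; it is at most |U|
    because |U| > 192n.\<close>
  moreover have "96 * card U \<le> card S + n * (96 * 96)"
    unfolding S_def using big \<open>n \<ge> 1\<close> by (intro card_quotient_set_ge U n) auto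
  ultimately show False using s big by linarith
qed

section \<open>Central subgroups of finite index\<close>

lemma nat_pow_eq_one_iff:
  assumes "x \<in> carrier G" "x \<noteq> \<one>"
  shows "x [^] (n::nat) = \<one> \<longleftrightarrow> n = 0"
  using torsion_free[of x n] assms by (cases n) auto

lemma int_pow_commute_eq:
  assumes "x \<in> carrier G" "y \<in> carrier G" "x \<otimes> y = y \<otimes> x"
  shows "x \<otimes> y [^] (i::int) = y [^] i \<otimes> x"
proof -
  have *: "x \<otimes> y [^] (n::nat) = y [^] n \<otimes> x" for n
  proof (induction n)
    case (Suc n)
    have "x \<otimes> y [^] Suc n = (x \<otimes> y [^] n) \<otimes> y"
      using assms by (simp add: m_assoc)
    also have "\<dots> = y [^] n \<otimes> (x \<otimes> y)"
      unfolding Suc using assms by (simp add: m_assoc)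
    also have "\<dots> = y [^] Suc n \<otimes> x"
      unfolding assms(3) using assms by (simp add: m_assoc)
    finally show ?case .
  qed (use assms in simp)
  show ?thesis
  proof (cases i rule: int_cases2)
    case (nonneg n)
    then show ?thesis using *[of n] by (simp add: int_pow_int)
  next
    case (nonpos n)
    have "y [^] n \<otimes> (x \<otimes> inv (y [^] n)) = y [^] n \<otimes> x \<otimes> inv (y [^] n)"
      using assms(1,2) by (simp add: m_assoc)
    also have "\<dots> = x \<otimes> y [^] n \<otimes> inv (y [^] n)"
      by (simp only: *)
    also have "\<dots> = x"
      using assms(1,2) by (simp add: m_assoc)
    finally have "x \<otimes> inv (y [^] n) = inv (y [^] n) \<otimes> x"
      using assms(1,2) by (subst inv_solve_left) auto
    then show ?thesis using assms(2) by (simp add: nonpos int_pow_neg_int)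
  qed
qed

text \<open>The transfer homomorphism: \<open>V g\<close> is the sum over coset representatives \<open>t\<close> of the exponent
  \<open>e\<close> in \<open>g t = t' z\<^sup>e\<close>. It multiplies exponents of \<open>z\<close> by the index, so its kernel is torsion,
  hence trivial.\<close>
lemma central_finite_index_imp_embeds_int:
  assumes H: "subgroup H G" and z: "z \<in> H" "z \<noteq> \<one>" and central: "\<And>h. h \<in> H \<Longrightarrow> h \<otimes> z = z \<otimes> h"
    and F: "finite F" "\<And>h. h \<in> H \<Longrightarrow> \<exists>f\<in>F. \<exists>i::int. f \<in> H \<and> h = f \<otimes> z [^] i"
  obtains V :: "'a \<Rightarrow> int" where "\<And>g h. g \<in> H \<Longrightarrow> h \<in> H \<Longrightarrow> V (g \<otimes> h) = V g + V h"
    "\<And>g. g \<in> H \<Longrightarrow> V g = 0 \<Longrightarrow> g = \<one>"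
proof -
  have Hc: "h \<in> carrier G" if "h \<in> H" for h
    using subgroup.mem_carrier[OF H that] .
  have Hm: "g \<otimes> h \<in> H" if "g \<in> H" "h \<in> H" for g h
    using subgroup.m_closed[OF H that] .
  have Hz: "z [^] (i::int) \<in> H" for i
    using subgroup_int_pow_closed[OF H z(1)] .
  have zc: "z \<in> carrier G" using Hc z by blast
  have cent: "h \<otimes> z [^] (i::int) = z [^] i \<otimes> h" if "h \<in> H" for h i
    using int_pow_commute_eq[OF Hc[OF that] zc central[OF that]] .
  \<comment> \<open>The choice is made from the set h<z>, so that all elements of one coset get the
    same representative.\<close>
  define rep where "rep h = (SOME f. f \<in> (\<lambda>i::int. h \<otimes> z [^] i) ` UNIV)" for h
  have ex: "\<exists>i::int. rep h = h \<otimes> z [^] i" for h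
  proof -
    have "rep h \<in> (\<lambda>i::int. h \<otimes> z [^] i) ` UNIV"
      unfolding rep_def by (rule someI[of _ "h \<otimes> z [^] (0::int)"]) blast
    then show ?thesis by blast
  qed
  have rep_eq: "rep (h \<otimes> z [^] (i::int)) = rep h" if "h \<in> H" for h i
  proof -
    have "(\<lambda>j::int. h \<otimes> z [^] i \<otimes> z [^] j) ` UNIV = (\<lambda>j::int. h \<otimes> z [^] j) ` UNIV"
    proof (intro equalityI subsetI)
      fix y assume "y \<in> (\<lambda>j::int. h \<otimes> z [^] i \<otimes> z [^] j) ` UNIV"
      then show "y \<in> (\<lambda>j::int. h \<otimes> z [^] j) ` UNIV"
        using Hc[OF that] zc by (auto simp: m_assoc simp flip: int_pow_mult)
    next
      fix y assume "y \<in> (\<lambda>j::int. h \<otimes> z [^] j) ` UNIV"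
      then obtain j where j: "y = h \<otimes> z [^] (j::int)" by blast
      have "y = h \<otimes> z [^] i \<otimes> z [^] (j - i)"
        using Hc[OF that] zc by (simp add: j m_assoc flip: int_pow_mult)
      then show "y \<in> (\<lambda>j::int. h \<otimes> z [^] i \<otimes> z [^] j) ` UNIV" by blast
    qed
    then show ?thesis by (simp add: rep_def)
  qed
  define e where "e h = (SOME i::int. h = rep h \<otimes> z [^] i)" for h
  have repH: "rep h \<in> H" if "h \<in> H" for h
    using ex[of h] that Hm Hz by auto
  have e: "h = rep h \<otimes> z [^] e h" if "h \<in> H" for h
  proof -
    obtain i where i: "rep h = h \<otimes> z [^] (i::int)" using ex by blast
    have "h = rep h \<otimes> z [^] (- i)"
      using Hc[OF that] zc by (simp add: i m_assoc flip: int_pow_mult)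
    then show ?thesis unfolding e_def by (rule someI)
  qed
  have e_unique: "e h = i" if "h \<in> H" "h = rep h \<otimes> z [^] (i::int)" for h i
  proof -
    have "rep h \<otimes> z [^] i = rep h \<otimes> z [^] e h" using that e[OF that(1)] by simp
    then show ?thesis
      using zc z Hc[OF repH[OF that(1)]] int_pow_eq_iff by simp
  qed
  have rep_rep: "rep (rep h) = rep h" if "h \<in> H" for h
    using ex[of h] rep_eq[OF that] by metis
  have e_mult: "e (h \<otimes> z [^] i) = e h + i" if "h \<in> H" for h i
  proof (rule e_unique)
    show "h \<otimes> z [^] i \<in> H" using that Hm Hz by blast
    have "h \<otimes> z [^] i = rep h \<otimes> z [^] e h \<otimes> z [^] i" using e[OF that] by simp
    then show "h \<otimes> z [^] i = rep (h \<otimes> z [^] i) \<otimes> z [^] (e h + i)"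
      unfolding rep_eq[OF that] using zc Hc[OF repH[OF that]] by (simp add: int_pow_mult m_assoc)
  qed
  define T where "T = rep ` H"
  have TH: "t \<in> H" if "t \<in> T" for t using that repH by (auto simp: T_def)
  have rT: "rep t = t" if "t \<in> T" for t using that rep_rep by (auto simp: T_def)
  have finT: "finite T"
  proof (rule finite_subset)
    show "T \<subseteq> rep ` F" using F(2) rep_eq by (force simp: T_def)
  qed (use F in simp)
  define V where "V g = (\<Sum>t\<in>T. e (g \<otimes> t))" for g
  have gt: "rep (g \<otimes> rep h) = rep (g \<otimes> h)" if gh: "g \<in> H" "h \<in> H" for g h
  proof -
    have "g \<otimes> h = (g \<otimes> rep h) \<otimes> z [^] e h"
      using e[OF gh(2)] gh Hc repH zc by (metis int_pow_closed m_assoc)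
    then show ?thesis using rep_eq[OF Hm[OF gh(1) repH[OF gh(2)]]] by metis
  qed
  have Hi: "inv g \<in> H" if "g \<in> H" for g using subgroup.m_inv_closed[OF H that] .
  have rep_inv: "rep (inv g \<otimes> rep (g \<otimes> t)) = t" if "g \<in> H" "t \<in> T" for g t
    using gt[of "inv g" "g \<otimes> t"] that Hc TH Hi Hm rT by (simp flip: m_assoc)
  \<comment> \<open>Left multiplication by g permutes the cosets of <z>; the inverse permutation
    belongs to g^-1.\<close>
  have bij: "bij_betw (\<lambda>t. rep (g \<otimes> t)) T T" if g: "g \<in> H" for g
  proof (rule bij_betw_byWitness[of _ "\<lambda>t. rep (inv g \<otimes> t)"])
    show "\<forall>t\<in>T. rep (inv g \<otimes> rep (g \<otimes> t)) = t" using rep_inv g by blast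
    show "\<forall>t\<in>T. rep (g \<otimes> rep (inv g \<otimes> t)) = t" using rep_inv[of "inv g"] g Hi Hc by simp
  qed (use g TH Hm Hi in \<open>auto simp: T_def\<close>)
  have hom: "V (g \<otimes> h) = V g + V h" if gh: "g \<in> H" "h \<in> H" for g h
  proof -
    \<comment> \<open>The cocycle identity. Summed over T, with its first term reindexed by the
      permutation t |-> rep (ht), it gives additivity.\<close>
    have "e (g \<otimes> h \<otimes> t) = e (g \<otimes> rep (h \<otimes> t)) + e (h \<otimes> t)" if "t \<in> T" for t
    proof -
      have ht: "h \<otimes> t \<in> H" using gh TH that Hm by blast
      then have "g \<otimes> h \<otimes> t = g \<otimes> rep (h \<otimes> t) \<otimes> z [^] e (h \<otimes> t)"
        using e[OF ht] gh TH[OF that] Hc repH[OF ht] zc by (metis int_pow_closed m_assoc)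
      then show ?thesis
        using e_mult[OF Hm[OF gh(1) repH[OF ht]]] by metis
    qed
    then have "V (g \<otimes> h) = (\<Sum>t\<in>T. e (g \<otimes> rep (h \<otimes> t))) + V h"
      by (simp add: V_def sum.distrib)
    also have "(\<Sum>t\<in>T. e (g \<otimes> rep (h \<otimes> t))) = V g"
      using sum.reindex_bij_betw[OF bij[OF gh(2)], of "\<lambda>t. e (g \<otimes> t)"] by (simp add: V_def)
    finally show ?thesis .
  qed
  \<comment> \<open>The representatives have exponent 0 and z is central, so every summand equals
    i.\<close>
  have Vz: "V (z [^] i) = int (card T) * i" for i :: int
  proof -
    have "e (z [^] i \<otimes> t) = i" if "t \<in> T" for t
    proof -
      have "e t = 0" using e_unique[of t 0] TH[OF that] rT[OF that] Hc by simp
      then show ?thesis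
        using e_mult[of t i] cent[of t i] TH[OF that] by simp
    qed
    then show ?thesis by (simp add: V_def)
  qed
  have V_one: "V \<one> = 0"
    using hom[of \<one> \<one>] subgroup.one_closed[OF H] by simp
  have "T \<noteq> {}" using subgroup.one_closed[OF H] by (auto simp: T_def)
  then have cT: "card T > 0" using finT by (simp add: card_gt_0_iff)
  \<comment> \<open>As T is finite, two powers of g lie in one coset, so some g^d with d >= 1 is a
    power of z. V vanishes on it, hence the exponent is 0 and g^d = 1.\<close>
  have ker: "g = \<one>" if g: "g \<in> H" "V g = 0" for g
  proof -
    have gn: "g [^] (n::nat) \<in> H" "V (g [^] n) = 0" for n
    proof (induction n)
      case 0 {case 1 show ?case using subgroup.one_closed[OF H] by simp next
        case 2 show ?case using V_one by simp}
    next
      case (Suc n) {case 1 show ?case using Suc Hm g by simp next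
        case 2 show ?case using Suc hom g by simp}
    qed
    have "\<not> inj_on (\<lambda>n::nat. rep (g [^] n)) UNIV"
    proof
      assume "inj_on (\<lambda>n::nat. rep (g [^] n)) UNIV"
      moreover have "range (\<lambda>n::nat. rep (g [^] n)) \<subseteq> T" using gn by (auto simp: T_def)
      ultimately show False using finT range_inj_infinite finite_subset by blast
    qed
    then obtain m n :: nat where mn: "m < n" "rep (g [^] m) = rep (g [^] n)"
      unfolding inj_on_def by (metis linorder_neqE_nat)
    have gc: "g \<in> carrier G" using Hc g by blast
    define d where "d = n - m"
    have "g [^] n = g [^] m \<otimes> g [^] d"
      using mn gc by (simp add: nat_pow_mult d_def)
    moreover have "g [^] n = g [^] m \<otimes> z [^] (e (g [^] n) - e (g [^] m))"
    proof -
      have "g [^] m \<otimes> z [^] (e (g [^] n) - e (g [^] m))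
          = rep (g [^] m) \<otimes> z [^] e (g [^] m) \<otimes> z [^] (e (g [^] n) - e (g [^] m))"
        by (simp only: e[OF gn(1), symmetric])
      also have "\<dots> = rep (g [^] n) \<otimes> z [^] e (g [^] n)"
        using zc Hc[OF repH[OF gn(1)]] by (simp add: mn m_assoc flip: int_pow_mult)
      finally show ?thesis by (simp only: e[OF gn(1), symmetric])
    qed
    ultimately have "g [^] m \<otimes> g [^] d = g [^] m \<otimes> z [^] (e (g [^] n) - e (g [^] m))"
      by (rule trans[OF sym])
    then have gd: "g [^] d = z [^] (e (g [^] n) - e (g [^] m))"
      using gc zc by simp
    then have "int (card T) * (e (g [^] n) - e (g [^] m)) = 0"
      using Vz gn(2)[of d] by metis
    then have "g [^] d = \<one>" using cT gd by simp
    then show "g = \<one>" using torsion_free[OF gc, of d] mn by (simp add: d_def)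
  qed
  show thesis using that[of V] hom ker by blast
qed

text \<open>As for subgroups of the integers: an element h with least positive V h generates,
  because g h^(-q) with q = V g div V h has value V g mod V h, hence 0, and the kernel is
  trivial.\<close>

lemma embeds_int_imp_cyclic:
  fixes V :: "'a \<Rightarrow> int"
  assumes H: "subgroup H G" and hom: "\<And>g h. g \<in> H \<Longrightarrow> h \<in> H \<Longrightarrow> V (g \<otimes> h) = V g + V h"
    and ker: "\<And>g. g \<in> H \<Longrightarrow> V g = 0 \<Longrightarrow> g = \<one>"
  shows "\<exists>h\<in>H. \<forall>g\<in>H. \<exists>i::int. g = h [^] i"
proof (cases "\<exists>h\<in>H. h \<noteq> \<one>")
  case False
  then show ?thesis using subgroup.one_closed[OF H] by (metis int_pow_0)
next
  case True
  have Hc: "h \<in> carrier G" if "h \<in> H" for h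
    using subgroup.mem_carrier[OF H that] .
  have V1: "V \<one> = 0"
    using hom[of \<one> \<one>] subgroup.one_closed[OF H] by simp
  have Hi: "inv g \<in> H" if "g \<in> H" for g using subgroup.m_inv_closed[OF H that] .
  have Vinv: "V (inv g) = - V g" if "g \<in> H" for g
    using hom[OF that Hi[OF that]] V1 Hc[OF that] by simp
  have Vnat: "V (g [^] n) = int n * V g" if "g \<in> H" for g and n :: nat
  proof (induction n)
    case (Suc n)
    have "g [^] n \<in> H"
      using subgroup_int_pow_closed[OF H that, of "int n"] by (simp add: int_pow_int)
    then show ?case using Suc hom that by (simp add: algebra_simps)
  qed (simp add: V1)
  have Vint: "V (g [^] i) = i * V g" if "g \<in> H" for g and i :: int
  proof (cases i rule: int_cases2)
    case (nonneg n)
    then show ?thesis by (simp add: Vnat[OF that] int_pow_int)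
  next
    case (nonpos n)
    have "g [^] n \<in> H"
      using subgroup_int_pow_closed[OF H that, of "int n"] by (simp add: int_pow_int)
    then show ?thesis
      by (simp add: nonpos int_pow_neg_int Hc[OF that] Vinv Vnat[OF that])
  qed
  have "\<exists>h. h \<in> H \<and> V h > 0"
  proof -
    obtain h where h: "h \<in> H" "V h \<noteq> 0" using True ker by blast
    then have "V h > 0 \<or> V (inv h) > 0" using Vinv[OF h(1)] by linarith
    then show ?thesis using h(1) Hi[OF h(1)] by blast
  qed
  then obtain h where h: "h \<in> H" "V h > 0" "\<And>g. g \<in> H \<Longrightarrow> V g > 0 \<Longrightarrow> nat (V h) \<le> nat (V g)"
    using ex_has_least_nat[of "\<lambda>h. h \<in> H \<and> V h > 0" _ "\<lambda>h. nat (V h)"] by metis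
  have "g = h [^] (V g div V h)" if "g \<in> H" for g
  proof -
    define r where "r = g \<otimes> h [^] (- (V g div V h))"
    have hp: "h [^] (- (V g div V h)) \<in> H"
      by (rule subgroup_int_pow_closed[OF H h(1)])
    have r: "r \<in> H" unfolding r_def using subgroup.m_closed[OF H that hp] .
    have "V r = V g mod V h"
      unfolding r_def using hom[OF that hp] Vint[OF h(1)] by (simp add: minus_div_mult_eq_mod)
    then have "V r = 0"
      using h(3)[OF r] h(2) pos_mod_bound[OF h(2), of "V g"] pos_mod_sign[OF h(2), of "V g"]
      by fastforce
    then have "r = \<one>" using ker r by blast
    then have "\<one> = g \<otimes> inv (h [^] (V g div V h))"
      using Hc[OF h(1)] by (simp only: r_def int_pow_neg)
    then have "g = \<one> \<otimes> h [^] (V g div V h)"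
      using Hc[OF that] Hc[OF h(1)] inv_solve_right by blast
    then show ?thesis
      using Hc[OF h(1)] by simp
  qed
  then show ?thesis using h(1) by blast
qed

end

section \<open>A bounded factor lies in a coset of a cyclic subgroup\<close>

context group
begin

lemma subgroup_Union_set_pow:
  assumes "S \<subseteq> carrier G" "m_inv G ` S \<subseteq> S"
  shows "subgroup (\<Union>n. set_pow G S n) G"
proof
  show "(\<Union>n. set_pow G S n) \<subseteq> carrier G" using set_pow_subset assms by blast
  show "\<one> \<in> (\<Union>n. set_pow G S n)" using set_pow.simps(1)[of G S] by blast
  show "x \<otimes> y \<in> (\<Union>n. set_pow G S n)" if "x \<in> (\<Union>n. set_pow G S n)" "y \<in> (\<Union>n. set_pow G S n)" for x y
    using that mem_set_pow_add[OF assms(1)] by blast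
  show "inv x \<in> (\<Union>n. set_pow G S n)" if "x \<in> (\<Union>n. set_pow G S n)" for x
    using that inv_mem_set_pow[OF assms] by blast
qed

lemma set_pow_commute:
  assumes S: "S \<subseteq> carrier G" and z: "z \<in> carrier G" "\<And>s. s \<in> S \<Longrightarrow> s \<otimes> z = z \<otimes> s"
    and "h \<in> set_pow G S n"
  shows "h \<otimes> z = z \<otimes> h"
  using assms(4)
proof (induction n arbitrary: h)
  case 0
  then show ?case using z by simp
next
  case (Suc n)
  then obtain f s where fs: "f \<in> set_pow G S n" "s \<in> S" "h = f \<otimes> s"
    by (auto simp: set_mult_def)
  have c: "f \<in> carrier G" "s \<in> carrier G" using fs S set_pow_subset by blast+
  have "h \<otimes> z = f \<otimes> z \<otimes> s" using fs c z by (simp add: m_assoc)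
  also have "\<dots> = z \<otimes> h" using Suc.IH[OF fs(1)] fs c z by (simp add: m_assoc)
  finally show ?case .
qed

end

section \<open>Common powers, a central element and quadratic growth\<close>

context torsion_free
begin

text \<open>Otherwise every a in A has a first i with 1 <= i <= s at which a x^i leaves A. That exit
  point lies in Ax - A, and for fixed i it determines a; so |A| <= s^2.\<close>

lemma ex_long_progression:
  assumes A: "finite A" "A \<subseteq> carrier G" and x: "x \<in> carrier G"
    and s: "card ((A #> x) - A) \<le> s" and large: "s * s < card A"
  shows "\<exists>a\<in>A. \<forall>i\<le>s. a \<otimes> x [^] (i::nat) \<in> A"
proof (rule ccontr)
  assume *: "\<not> ?thesis"
  let ?D = "\<lambda>i::nat. {a \<in> A. a \<otimes> x [^] i \<in> (A #> x) - A}"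
  have cA: "a \<in> carrier G" if "a \<in> A" for a using that A by blast
  have "A \<subseteq> (\<Union>i\<in>{1..s}. ?D i)"
  proof
    fix a assume a: "a \<in> A"
    define i where "i = (LEAST i::nat. a \<otimes> x [^] i \<notin> A)"
    obtain j where j: "j \<le> s" "a \<otimes> x [^] (j::nat) \<notin> A" using * a by blast
    have i: "a \<otimes> x [^] i \<notin> A" unfolding i_def using j(2) by (rule LeastI)
    have "i \<le> s" using Least_le[of "\<lambda>i. a \<otimes> x [^] i \<notin> A" j] j by (simp add: i_def)
    moreover have "i \<noteq> 0" using i a cA by (intro notI) simp
    moreover have "a \<otimes> x [^] i \<in> A #> x"
    proof -
      obtain m where m: "i = Suc m" using \<open>i \<noteq> 0\<close> not0_implies_Suc by blast
      then have "a \<otimes> x [^] m \<in> A" using not_less_Least[of m "\<lambda>i. a \<otimes> x [^] i \<notin> A"] by (simp add: i_def)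
      moreover have "a \<otimes> x [^] i = a \<otimes> x [^] m \<otimes> x" using m x cA[OF a] by (simp add: m_assoc)
      ultimately show ?thesis by (auto simp: r_coset_eq_image)
    qed
    ultimately show "a \<in> (\<Union>i\<in>{1..s}. ?D i)" using a i by auto
  qed
  then have "card A \<le> card (\<Union>i\<in>{1..s}. ?D i)"
    using A by (intro card_mono) auto
  also have "\<dots> \<le> (\<Sum>i\<in>{1..s}. card (?D i))"
    by (intro card_UN_le) simp
  also have "\<dots> \<le> (\<Sum>i\<in>{1..s}. s)"
  proof (rule sum_mono)
    fix i assume "i \<in> {1..s}"
    have "card (?D i) \<le> card ((A #> x) - A)"
    proof (rule card_inj_on_le)
      show "inj_on (\<lambda>a. a \<otimes> x [^] i) (?D i)" using cA x by (auto simp: inj_on_def)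
    qed (use A in \<open>auto intro: finite_r_coset\<close>)
    then show "card (?D i) \<le> s" using s by simp
  qed
  finally show False using large by simp
qed

text \<open>A contains a progression a, ax, ..., a x^s of s + 1 terms. From each term, repeated
  multiplication by y leaves A at a point of Ay - A. That set has at most s elements, so two exit
  points coincide, and x^d is a power of y for the difference d of the two indices.\<close>

lemma ex_common_power:
  assumes A: "finite A" "A \<subseteq> carrier G" and x: "x \<in> carrier G" and y: "y \<in> carrier G" "y \<noteq> \<one>"
    and s: "card ((A #> x) - A) \<le> s" "card ((A #> y) - A) \<le> s" and large: "s * s < card A"
  shows "\<exists>i::nat. 1 \<le> i \<and> i \<le> s \<and> (\<exists>j::int. x [^] i = y [^] j)"
proof -
  obtain a where a: "a \<in> A" "\<And>i::nat. i \<le> s \<Longrightarrow> a \<otimes> x [^] i \<in> A"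
    using ex_long_progression[OF A x s(1) large] by blast
  have ac: "a \<in> carrier G" using a A by blast
  have "\<exists>m::nat. a \<otimes> x [^] i \<otimes> y [^] m \<in> (A #> y) - A" if "i \<le> s" for i
  proof -
    define X where "X = {b \<in> A. \<exists>m::nat. b = a \<otimes> x [^] i \<otimes> y [^] m}"
    have "a \<otimes> x [^] i = a \<otimes> x [^] i \<otimes> y [^] (0::nat)" using ac x by simp
    then have "a \<otimes> x [^] i \<in> X" using a(2)[OF that] unfolding X_def by blast
    moreover have "finite X" "X \<subseteq> carrier G" using A by (auto simp: X_def)
    ultimately obtain b where b: "b \<in> X" "b \<otimes> y \<notin> X" using ex_mult_notin[of X y] y by blast
    then obtain m where m: "b \<in> A" "b = a \<otimes> x [^] i \<otimes> y [^] (m::nat)" by (auto simp: X_def)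
    have by_eq: "b \<otimes> y = a \<otimes> x [^] i \<otimes> y [^] Suc m" using m(2) ac x y by (simp add: m_assoc)
    then have "b \<otimes> y \<notin> A" using b(2) unfolding X_def by blast
    moreover have "b \<otimes> y \<in> A #> y" using m(1) by (auto simp: r_coset_eq_image)
    ultimately show ?thesis using by_eq by (intro exI[of _ "Suc m"]) simp
  qed
  then obtain m :: "nat \<Rightarrow> nat"
    where m: "\<And>i. i \<le> s \<Longrightarrow> a \<otimes> x [^] i \<otimes> y [^] m i \<in> (A #> y) - A" by metis
  define e where "e i = a \<otimes> x [^] i \<otimes> y [^] m i" for i
  have "\<not> inj_on e {..s}"
  proof
    assume "inj_on e {..s}"
    then have "card {..s} \<le> card ((A #> y) - A)"
      using m A by (intro card_inj_on_le[of e]) (auto simp: e_def intro: finite_r_coset)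
    then show False using s(2) by simp
  qed
  then obtain i i' where i: "i < i'" "i' \<le> s" "e i = e i'"
    unfolding inj_on_def by (metis atMost_iff linorder_neqE_nat)
  define d where "d = i' - i"
  have "a \<otimes> x [^] i \<otimes> y [^] m i = a \<otimes> x [^] i \<otimes> (x [^] d \<otimes> y [^] m i')"
  proof -
    have "x [^] i' = x [^] i \<otimes> x [^] d" using i(1) x by (simp add: nat_pow_mult d_def)
    then show ?thesis using i(3) ac x y by (simp add: e_def m_assoc)
  qed
  then have "y [^] m i = x [^] d \<otimes> y [^] m i'"
    using ac x y by simp
  then have "x [^] d = y [^] m i \<otimes> inv (y [^] m i')"
    using x y by (simp add: m_assoc)
  also have "\<dots> = y [^] (int (m i) - int (m i'))"
    using y by (simp add: int_pow_diff int_pow_int)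
  finally show ?thesis using i by (intro exI[of _ d]) (auto simp: d_def)
qed

text \<open>Each S^(n+1) reaches a coset of <z> that S^n does not meet, so S^n meets at least n + 1
  cosets. Each of them yields r elements after multiplication by 1, z, ..., z^(r-1), at the cost of
  rN further factors.\<close>

lemma quadratic_growth:
  assumes S: "finite S" "S \<subseteq> carrier G" "\<one> \<in> S" and z: "z \<in> set_pow G S N" "z \<noteq> \<one>"
    and g: "\<And>n. \<exists>g\<in>set_pow G S (Suc n). \<forall>f\<in>set_pow G S n. \<forall>i::int. g \<noteq> f \<otimes> z [^] i"
  shows "(n + 1) * r \<le> card (set_pow G S (n + r * N))"
proof -
  have zc: "z \<in> carrier G" using z set_pow_subset[OF S(2)] by blast
  have pc: "f \<in> carrier G" if "f \<in> set_pow G S m" for f m using that set_pow_subset[OF S(2)] by blast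
  define W where "W = (\<lambda>l::nat. z [^] l) ` {..<r}"
  have inj: "z [^] (l::nat) = z [^] (l'::nat) \<longleftrightarrow> l = l'" for l l'
    using int_pow_eq_iff[OF zc z(2), of "int l" "int l'"] by (simp add: int_pow_int)
  have W: "finite W" "card W = r" "W \<subseteq> carrier G"
    using zc inj by (auto simp: W_def card_image inj_on_def)
  have sub: "set_pow G S m <#> W \<subseteq> set_pow G S (m + r * N)" for m
  proof
    fix y assume "y \<in> set_pow G S m <#> W"
    then obtain f l where fl: "f \<in> set_pow G S m" "l < r" "y = f \<otimes> z [^] (l::nat)"
      by (auto simp: set_mult_def W_def)
    have "y \<in> set_pow G S (m + l * N)"
      unfolding fl(3) by (rule mem_set_pow_add[OF S(2) fl(1) nat_pow_mem_set_pow[OF S(2) z(1)]])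
    moreover have "m + l * N \<le> m + r * N" using fl(2) by simp
    ultimately show "y \<in> set_pow G S (m + r * N)" using set_pow_mono[OF S(2,3)] by blast
  qed
  have "(n + 1) * r \<le> card (set_pow G S n <#> W)"
  proof (induction n)
    case 0
    have "W \<subseteq> set_pow G S 0 <#> W" using W(3) by (force simp: set_mult_def)
    then have "card W \<le> card (set_pow G S 0 <#> W)"
      using W by (intro card_mono finite_set_mult finite_set_pow S)
    then show ?case by (simp only: W add_0 mult_1)
  next
    case (Suc n)
    obtain g where g: "g \<in> set_pow G S (Suc n)" "\<And>f i. f \<in> set_pow G S n \<Longrightarrow> g \<noteq> f \<otimes> z [^] (i::int)"
      using assms(6)[of n] by blast
    have gc: "g \<in> carrier G" using pc g by blast
    let ?X = "set_pow G S n <#> W" and ?Y = "(\<lambda>w. g \<otimes> w) ` W"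
    have "?X \<inter> ?Y = {}"
    proof (rule ccontr)
      assume "?X \<inter> ?Y \<noteq> {}"
      then obtain y where y: "y \<in> ?X" "y \<in> ?Y" by blast
      obtain f l where fl: "f \<in> set_pow G S n" "y = f \<otimes> z [^] (l::nat)"
        using y(1) by (auto simp: set_mult_def W_def)
      obtain l' where "y = g \<otimes> z [^] (l'::nat)"
        using y(2) by (auto simp: W_def)
      with fl have f: "f \<in> set_pow G S n" "f \<otimes> z [^] l = g \<otimes> z [^] l'"
        by simp_all
      have "g = f \<otimes> z [^] l \<otimes> inv (z [^] l')"
        using f gc zc pc[OF f(1)] by (simp add: m_assoc)
      also have "\<dots> = f \<otimes> z [^] (int l - int l')"
        using zc pc[OF f(1)] by (simp add: int_pow_diff int_pow_int m_assoc)
      finally show False using g(2)[OF f(1)] by blast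
    qed
    then have "card (?X \<union> ?Y) = card ?X + card ?Y"
      using W S by (intro card_Un_disjoint finite_set_mult finite_set_pow) auto
    moreover have "card ?Y = r"
      using W(2,3) gc by (subst card_image) (auto simp: inj_on_def subset_iff)
    moreover have "card (?X \<union> ?Y) \<le> card (set_pow G S (Suc n) <#> W)"
    proof (intro card_mono finite_set_mult finite_set_pow S W)
      have "?X \<subseteq> set_pow G S (Suc n) <#> W"
        using set_pow_Suc_mono[OF S(2,3)] by (rule mono_set_mult) simp
      moreover have "?Y \<subseteq> set_pow G S (Suc n) <#> W" using g(1) mem_set_mult by blast
      ultimately show "?X \<union> ?Y \<subseteq> set_pow G S (Suc n) <#> W" by blast
    qed
    ultimately show ?case using Suc by (simp only: add_mult_distrib mult_1 Suc_eq_plus1)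
  qed
  also have "\<dots> \<le> card (set_pow G S (n + r * N))"
    by (intro card_mono finite_set_pow S sub)
  finally show ?thesis .
qed

text \<open>Without quadratic growth no new coset of <z> appears at some stage: S^(m+1) is contained
  in S^m <z>. As z is central, the same follows for all powers of S, so <z> has finite index in the
  group generated by S, and the transfer applies.\<close>

lemma small_growth_imp_cyclic:
  assumes S: "finite S" "S \<subseteq> carrier G" "\<one> \<in> S" "m_inv G ` S \<subseteq> S"
    and z: "z \<in> set_pow G S N" "z \<noteq> \<one>" "\<And>s. s \<in> S \<Longrightarrow> s \<otimes> z = z \<otimes> s"
    and small: "card (set_pow G S (n + r * N)) < (n + 1) * r"
  shows "\<exists>h\<in>carrier G. \<forall>g\<in>S. \<exists>i::int. g = h [^] i"
proof -
  obtain m where m: "\<And>g. g \<in> set_pow G S (Suc m) \<Longrightarrow> \<exists>f\<in>set_pow G S m. \<exists>i::int. g = f \<otimes> z [^] i"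
    using quadratic_growth[OF S(1-3) z(1,2), of n r] small by (meson not_le)
  define H where "H = (\<Union>n. set_pow G S n)"
  have H: "subgroup H G" unfolding H_def by (rule subgroup_Union_set_pow[OF S(2,4)])
  have Hc: "h \<in> carrier G" if "h \<in> H" for h using subgroup.mem_carrier[OF H that] .
  have zH: "z \<in> H" using z by (auto simp: H_def)
  have zc: "z \<in> carrier G" using Hc zH by blast
  have SH: "S \<subseteq> H" using mem_set_pow_1[OF S(2)] by (auto simp: H_def simp del: set_pow.simps)
  have central: "h \<otimes> z = z \<otimes> h" if "h \<in> H" for h
    using that set_pow_commute[OF S(2) zc z(3)] by (auto simp: H_def)
  have "\<exists>f\<in>set_pow G S m. \<exists>i::int. h = f \<otimes> z [^] i" if "h \<in> set_pow G S l" for l h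
    using that
  proof (induction l arbitrary: h)
    case 0
    then have "h \<in> set_pow G S m" "h = h \<otimes> z [^] (0::int)"
      using set_pow_mono[OF S(2,3), of 0 m] by auto
    then show ?case by blast
  next
    case (Suc l)
    then obtain h' t where h': "h' \<in> set_pow G S l" "t \<in> S" "h = h' \<otimes> t" by (auto simp: set_mult_def)
    obtain f i where f: "f \<in> set_pow G S m" "h' = f \<otimes> z [^] (i::int)" using Suc.IH h'(1) by blast
    have tc: "t \<in> carrier G" "f \<in> carrier G" using h' f S(2) set_pow_subset[OF S(2)] by blast+
    have "f \<otimes> t \<in> set_pow G S (Suc m)" using f h' by (auto intro: mem_set_mult)
    then obtain f' j where f': "f' \<in> set_pow G S m" "f \<otimes> t = f' \<otimes> z [^] (j::int)" using m by blast
    have "f' \<in> carrier G" using f' set_pow_subset[OF S(2)] by blast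
    have "h = f \<otimes> (z [^] i \<otimes> t)" using h' f tc zc by (simp add: m_assoc)
    also have "z [^] i \<otimes> t = t \<otimes> z [^] i" using int_pow_commute_eq[OF tc(1) zc z(3)[OF h'(2)]] by simp
    also have "f \<otimes> (t \<otimes> z [^] i) = f' \<otimes> z [^] j \<otimes> z [^] i"
      using tc zc f'(2) by (simp flip: m_assoc)
    also have "\<dots> = f' \<otimes> z [^] (j + i)" using \<open>f' \<in> carrier G\<close> zc by (simp add: m_assoc int_pow_mult)
    finally show ?case using f'(1) by blast
  qed
  then have F: "\<exists>f\<in>set_pow G S m. \<exists>i::int. f \<in> H \<and> h = f \<otimes> z [^] i" if "h \<in> H" for h
    using that unfolding H_def by blast
  obtain V :: "'a \<Rightarrow> int" where V: "\<And>g h. g \<in> H \<Longrightarrow> h \<in> H \<Longrightarrow> V (g \<otimes> h) = V g + V h"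
    "\<And>g. g \<in> H \<Longrightarrow> V g = 0 \<Longrightarrow> g = \<one>"
    using central_finite_index_imp_embeds_int[OF H zH z(2) central finite_set_pow[OF S(1)] F] by blast
  have "\<exists>h\<in>H. \<forall>g\<in>H. \<exists>i::int. g = h [^] i"
    using V by (rule embeds_int_imp_cyclic[OF H])
  then show ?thesis using SH Hc by blast
qed

text \<open>All elements of \<open>U U\<^sup>-\<^sup>1\<close> have bounded powers in common; a common power is central in the
  group they generate, and unless this group is cyclic, powers of \<open>U U\<^sup>-\<^sup>1\<close> grow quadratically.\<close>
lemma small_right_factor_cyclic:
  assumes A: "finite A" "A \<subseteq> carrier G" and U: "finite U" "U \<subseteq> carrier G"
    and AU: "card (A <#> U) \<le> card A + s" and large: "4 * fact s * s * (8 * s + 1) < card A"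
  shows "\<exists>h\<in>carrier G. \<exists>u\<in>carrier G. \<forall>v\<in>U. \<exists>i::int. v = h [^] i \<otimes> u"
proof (cases "\<exists>u\<in>U. \<exists>v\<in>U. u \<noteq> v")
  case False
  show ?thesis
  proof (cases "U = {}")
    case False
    then obtain u where "u \<in> U" by blast
    then have "\<forall>v\<in>U. v = \<one> [^] (0::int) \<otimes> u" "u \<in> carrier G"
      using \<open>\<not> (\<exists>u\<in>U. \<exists>v\<in>U. u \<noteq> v)\<close> U by auto
    then show ?thesis by blast
  qed auto
next
  case True
  then obtain u v where uv: "u \<in> U" "v \<in> U" "u \<noteq> v" by blast
  define S where "S = U <#> (m_inv G ` U)"
  note S = quotient_set_closed(1-4)[OF U uv, folded S_def]
  define x where "x = u \<otimes> inv v"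
  have x: "x \<in> S" "x \<noteq> \<one>" using quotient_set_closed(5,6)[OF U uv] by (simp_all add: S_def x_def)
  have Sc: "y \<in> carrier G" if "y \<in> S" for y using that S by blast
  have s: "card ((A #> g) - A) \<le> s" if "g \<in> S" for g
    using card_r_coset_quotient_diff[OF A U AU] that by (simp add: S_def)
  have "A \<noteq> {}" using large by auto
  then obtain a where a: "a \<in> A" "a \<otimes> x \<notin> A"
    using ex_mult_notin[OF A(1) _ A(2) Sc[OF x(1)] x(2)] by blast
  then have "(A #> x) - A \<noteq> {}" by (auto simp: r_coset_eq_image)
  then have "0 < card ((A #> x) - A)" using A finite_r_coset by (simp add: card_gt_0_iff)
  then have s0: "s > 0" using s[OF x(1)] by linarith
  \<comment> \<open>s! is a multiple of every exponent i <= s that \<open>ex_common_power\<close>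
    can produce, so x^N is a power of each nontrivial y in S and commutes with it.\<close>
  define N where "N = (fact s :: nat)"
  have N: "N > 0" by (simp add: N_def)
  have "s * s \<le> 4 * N * s * (8 * s + 1)"
  proof -
    have "s * s \<le> s * (8 * s + 1)" by simp
    also have "\<dots> \<le> (4 * N) * (s * (8 * s + 1))" using N by simp
    finally show ?thesis by (simp only: mult.assoc)
  qed
  then have ss: "s * s < card A" using large by (simp only: N_def)
  define z where "z = x [^] N"
  have z: "z \<in> set_pow G S N"
    using nat_pow_mem_set_pow[OF S(2) mem_set_pow_1[OF S(2) x(1)], of N] by (simp add: z_def)
  have z1: "z \<noteq> \<one>" using nat_pow_eq_one_iff[of x N] x Sc N by (simp add: z_def)
  have comm: "y \<otimes> z = z \<otimes> y" if yS: "y \<in> S" for y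
  proof (cases "y = \<one>")
    case True
    then show ?thesis using Sc x by (simp add: z_def)
  next
    case False
    obtain i j where i: "1 \<le> i" "i \<le> s" "x [^] (i::nat) = y [^] (j::int)"
      using ex_common_power[OF A Sc[OF x(1)] Sc[OF yS] False s[OF x(1)] s[OF yS] ss] by blast
    obtain d where d: "N = i * d"
      using dvd_fact[OF i(1,2)] by (auto simp: N_def elim: dvdE)
    have "z = (y [^] j) [^] d"
      using Sc x by (simp add: z_def d nat_pow_pow flip: i(3))
    also have "\<dots> = y [^] (j * int d)"
      using Sc[OF yS] int_pow_pow[of y j "int d"] by (simp add: int_pow_int mult.commute)
    finally show ?thesis
      using int_pow_commute_eq[of y y] Sc[OF yS] by simp
  qed
  \<comment> \<open>Elements of S^(2Nr) displace at most 2Nrs <= |A|/2 points of A, so |S^(2Nr)| <=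
    2|A|. The assumed size of A gives r >= 8s + 1, and then 2|A| < 8Ns(r + 1) <= N r^2, short of
    quadratic growth.\<close>
  define r where "r = card A div (4 * N * s)"
  have pos: "4 * N * s > 0" using N s0 by simp
  have r1: "8 * s + 1 \<le> r"
  proof -
    have "(8 * s + 1) * (4 * N * s) \<le> card A" using large by (simp only: N_def mult_ac)
    then show ?thesis unfolding r_def using pos by (simp only: less_eq_div_iff_mult_less_eq)
  qed
  have r2: "card A < 4 * N * s * (r + 1)"
    unfolding r_def using dividend_less_times_div[OF pos, of "card A"] by simp
  have r3: "4 * N * s * r \<le> card A"
    unfolding r_def by simp
  have "card (set_pow G S (N * r + r * N)) \<le> 2 * card A"
  proof (rule card_set_pow_mult_le[OF A S(1,2) s])
    have "2 * ((N * r + r * N) * s) = 4 * N * s * r" by (simp add: algebra_simps)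
    then show "2 * ((N * r + r * N) * s) \<le> card A" using r3 by (simp only:)
  qed (use \<open>A \<noteq> {}\<close> in auto)
  also have "\<dots> < 8 * N * s * (r + 1)" using r2 by simp
  also have "\<dots> \<le> N * (r * r)"
  proof -
    have "8 * s * (r + 1) \<le> (8 * s + 1) * r" using r1 by simp
    also have "\<dots> \<le> r * r" using r1 by (rule mult_le_mono1)
    finally show ?thesis using mult_le_mono2[of "8 * s * (r + 1)" "r * r" N] by (simp only: mult_ac)
  qed
  also have "\<dots> \<le> (N * r + 1) * r" by simp
  finally have small: "card (set_pow G S (N * r + r * N)) < (N * r + 1) * r" .
  obtain h where h: "h \<in> carrier G" "\<And>g. g \<in> S \<Longrightarrow> \<exists>i::int. g = h [^] i"
    using small_growth_imp_cyclic[OF S z z1 comm small] by blast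
  have "\<exists>i::int. w = h [^] i \<otimes> u" if "w \<in> U" for w
  proof -
    have "w \<otimes> inv u \<in> S" using that uv by (auto simp: S_def intro: mem_set_mult)
    then obtain i where "w \<otimes> inv u = h [^] (i::int)" using h by blast
    then have "w = h [^] i \<otimes> u"
      using that uv U h(1) inv_solve_right[of "h [^] i" w u] by (auto simp: subset_iff)
    then show ?thesis by blast
  qed
  then show ?thesis using h(1) uv U by blast
qed

end

section \<open>Cosets of cyclic subgroups\<close>

context group
begin

text \<open>The preceding arguments produce a generator and a base point, so the definition is
  brought into that form; the content is that powers in a subgroup agree with powers in
  \<open>G\<close>.\<close>

lemma in_left_coset_of_cyclic_iff:
  "in_left_coset_of_cyclic G A \<longleftrightarrow>
    (\<exists>h\<in>carrier G. \<exists>g\<in>carrier G. \<forall>a\<in>A. \<exists>i::int. a = g \<otimes> h [^] i)"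
proof
  assume "in_left_coset_of_cyclic G A"
  then obtain H g where H: "subgroup H G" "cyclic_group (G\<lparr>carrier := H\<rparr>)"
    and g: "g \<in> carrier G" "A \<subseteq> g <# H"
    by (auto simp: in_left_coset_of_cyclic_def)
  obtain h where h: "h \<in> H" "H = range (\<lambda>n::int. h [^]\<^bsub>G\<lparr>carrier := H\<rparr>\<^esub> n)"
    using group.cyclic_group[OF subgroup_imp_group[OF H(1)]] H(2) by auto
  have "\<exists>i::int. a = g \<otimes> h [^] i" if a: "a \<in> A" for a
  proof -
    obtain y where y: "y \<in> H" "a = g \<otimes> y" using subsetD[OF g(2) a] by (auto simp: l_coset_def)
    then obtain i :: int where "y = h [^]\<^bsub>G\<lparr>carrier := H\<rparr>\<^esub> i" using h(2) by blast
    then show ?thesis using y(2) int_pow_consistent[OF H(1) h(1)] by metis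
  qed
  then show "\<exists>h\<in>carrier G. \<exists>g\<in>carrier G. \<forall>a\<in>A. \<exists>i::int. a = g \<otimes> h [^] i"
    using g(1) h(1) subgroup.mem_carrier[OF H(1)] by blast
next
  assume "\<exists>h\<in>carrier G. \<exists>g\<in>carrier G. \<forall>a\<in>A. \<exists>i::int. a = g \<otimes> h [^] i"
  then obtain h g where hg: "h \<in> carrier G" "g \<in> carrier G" "\<And>a. a \<in> A \<Longrightarrow> \<exists>i::int. a = g \<otimes> h [^] i"
    by blast
  define H where "H = generate G {h}"
  have H: "subgroup H G" unfolding H_def using hg by (intro generate_is_subgroup) simp
  have Heq: "H = range (\<lambda>i::int. h [^] i)" unfolding H_def generate_pow[OF hg(1)] by blast
  have hH: "h \<in> H" unfolding H_def by (rule generate.incl) simp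
  have "H = range (\<lambda>n::int. h [^]\<^bsub>G\<lparr>carrier := H\<rparr>\<^esub> n)"
    using Heq int_pow_consistent[OF H hH] by simp
  then have "cyclic_group (G\<lparr>carrier := H\<rparr>)"
    using hH group.cyclic_group[OF subgroup_imp_group[OF H]] by auto
  moreover have "A \<subseteq> g <# H" using hg(3) Heq by (force simp: l_coset_def)
  ultimately show "in_left_coset_of_cyclic G A"
    using H hg(2) by (auto simp: in_left_coset_of_cyclic_def)
qed

text \<open>Carries the property from a copy of a subgroup on \<open>nat\<close> back into the
  original group.\<close>

lemma in_left_coset_of_cyclic_hom_image:
  assumes "group K" "f \<in> hom G K" "in_left_coset_of_cyclic G A"
  shows "in_left_coset_of_cyclic K (f ` A)"
proof -
  interpret f: group_hom G K f
    using assms(1,2) group_axioms by (simp add: group_hom_def group_hom_axioms_def)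
  obtain h g where hg: "h \<in> carrier G" "g \<in> carrier G" "\<forall>a\<in>A. \<exists>i::int. a = g \<otimes> h [^] i"
    using assms(3) unfolding in_left_coset_of_cyclic_iff by blast
  have "\<exists>i::int. f a = f g \<otimes>\<^bsub>K\<^esub> f h [^]\<^bsub>K\<^esub> i" if "a \<in> A" for a
  proof -
    obtain i :: int where "a = g \<otimes> h [^] i" using bspec[OF hg(3) \<open>a \<in> A\<close>] by (elim exE)
    then have "f a = f g \<otimes>\<^bsub>K\<^esub> f h [^]\<^bsub>K\<^esub> i" using f.hom_mult[OF hg(2) int_pow_closed[OF hg(1)]] f.hom_int_pow[OF hg(1)] by metis
    then show ?thesis by blast
  qed
  then show ?thesis
    unfolding group.in_left_coset_of_cyclic_iff[OF assms(1)] using hg(1,2)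
    by (intro bexI[of _ "f h"] bexI[of _ "f g"]) auto
qed

end

section \<open>The threshold\<close>

context torsion_free
begin

lemma ex_last_mult_mem:
  assumes "finite A" "A \<subseteq> carrier G" "h \<in> carrier G" "h \<noteq> \<one>" "a \<in> A"
  obtains n :: nat where "a \<otimes> h [^] n \<in> A" "\<And>l::nat. l \<ge> 1 \<Longrightarrow> a \<otimes> h [^] n \<otimes> h [^] l \<notin> A"
proof -
  define N where "N = {n::nat. a \<otimes> h [^] n \<in> A}"
  have ac: "a \<in> carrier G" using assms by blast
  have "inj (\<lambda>n::nat. a \<otimes> h [^] n)"
    using ac assms int_pow_eq_iff[of h "int _" "int _"] by (auto simp: inj_def int_pow_int)
  then have N: "finite N"
    using finite_vimageI[OF assms(1)] by (simp add: N_def vimage_def)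
  have "0 \<in> N" using ac assms by (simp add: N_def)
  then have "Max N \<in> N" using N Max_in by blast
  moreover have "Max N + l \<notin> N" if "l \<ge> 1" for l
    using Max_ge[OF N, of "Max N + l"] that by auto
  ultimately show thesis
    using that[of "Max N"] ac assms(3) by (simp add: N_def m_assoc nat_pow_mult)
qed

text \<open>Let \<open>u\<close> be the first element of the progression \<open>U\<close>. Each coset \<open>a \<langle>h\<rangle>\<close> meeting \<open>A\<close> has a
  last element \<open>b\<close> in \<open>A\<close>, and the products \<open>b v\<close> with \<open>v \<noteq> u\<close> lie outside \<open>A u\<close>.\<close>
lemma right_factor_cyclic_imp_left_factor_cyclic:
  assumes A: "finite A" "A \<subseteq> carrier G" "A \<noteq> {}" and U: "finite U" "U \<subseteq> carrier G"
    and h: "h \<in> carrier G" and u: "u \<in> carrier G" and Uh: "\<And>v. v \<in> U \<Longrightarrow> \<exists>i::int. v = h [^] i \<otimes> u"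
    and k: "card (A <#> U) \<le> card A + card U + k" "k + 3 \<le> card U"
  shows "\<exists>a\<in>carrier G. \<forall>b\<in>A. \<exists>i::int. b = a \<otimes> h [^] i"
proof (rule ccontr)
  assume *: "\<not> ?thesis"
  have cA: "a \<in> carrier G" if "a \<in> A" for a using that A by blast
  obtain a where a: "a \<in> A" using A by blast
  \<comment> \<open>By assumption \<open>A\<close> meets a second coset of <h>.\<close>
  obtain a' where a': "a' \<in> A" "\<And>i::int. a' \<noteq> a \<otimes> h [^] i" using * cA[OF a] by blast
  have h1: "h \<noteq> \<one>"
  proof
    assume "h = \<one>"
    then have "U \<subseteq> {u}" using Uh u by auto
    then have "card U \<le> 1" using card_mono[of "{u}" U] by simp
    then show False using k by simp
  qed
  \<comment> \<open>The exponents occurring in \<open>U\<close>; the smallest one gives the first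
    element \<open>u0\<close> of the progression.\<close>
  define I where "I = {i::int. h [^] i \<otimes> u \<in> U}"
  have "inj (\<lambda>i::int. h [^] i \<otimes> u)" using u h int_pow_eq_iff[OF h h1] by (auto simp: inj_def)
  then have I: "finite I" using finite_vimageI[OF U(1)] by (simp add: I_def vimage_def)
  have "U \<noteq> {}" using k by auto
  then have "I \<noteq> {}" using Uh by (auto simp: I_def)
  define u0 where "u0 = h [^] Min I \<otimes> u"
  have u0: "u0 \<in> U" using Min_in[OF I \<open>I \<noteq> {}\<close>] by (simp add: I_def u0_def)
  have u0c: "u0 \<in> carrier G" using u0 U by blast
  have Uu0: "\<exists>l::nat. l \<ge> 1 \<and> v = h [^] l \<otimes> u0" if "v \<in> U - {u0}" for v
  proof -
    obtain i where i: "v = h [^] (i::int) \<otimes> u" using Uh \<open>v \<in> U - {u0}\<close> by blast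
    then have "i \<in> I" using that by (simp add: I_def)
    then have "Min I \<le> i" using I by simp
    moreover have "i \<noteq> Min I" using that i by (auto simp: u0_def)
    ultimately obtain l where l: "i = Min I + int l" "l \<ge> 1"
      by (metis zle_iff_zadd add.right_neutral le_less_linear less_one of_nat_0)
    have "v = h [^] (int l + Min I) \<otimes> u" using i l(1) by (simp only: add.commute)
    also have "\<dots> = h [^] int l \<otimes> h [^] Min I \<otimes> u" using h by (simp only: int_pow_mult)
    also have "\<dots> = h [^] l \<otimes> u0" using u h by (simp add: u0_def m_assoc int_pow_int)
    finally show ?thesis using l(2) by (intro exI conjI)
  qed
  obtain n :: nat where n: "a \<otimes> h [^] n \<in> A" "\<And>l::nat. l \<ge> 1 \<Longrightarrow> a \<otimes> h [^] n \<otimes> h [^] l \<notin> A"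
    using ex_last_mult_mem[OF A(1,2) h h1 a] by blast
  obtain n' :: nat where n': "a' \<otimes> h [^] n' \<in> A" "\<And>l::nat. l \<ge> 1 \<Longrightarrow> a' \<otimes> h [^] n' \<otimes> h [^] l \<notin> A"
    using ex_last_mult_mem[OF A(1,2) h h1 a'(1)] by blast
  define b b' where "b = a \<otimes> h [^] n" and "b' = a' \<otimes> h [^] n'"
  note n = n[folded b_def b'_def] and n' = n'[folded b_def b'_def]
  let ?X = "\<lambda>b. (\<lambda>v. b \<otimes> v) ` (U - {u0})"
  have cU: "v \<in> carrier G" if "v \<in> U" for v using that U by blast
  have disj: "(A #> u0) \<inter> ?X b = {}"
    if b: "b \<in> A" "\<And>l::nat. l \<ge> 1 \<Longrightarrow> b \<otimes> h [^] l \<notin> A" for b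
  proof (rule ccontr)
    assume "(A #> u0) \<inter> ?X b \<noteq> {}"
    then obtain c v where cv: "c \<in> A" "v \<in> U - {u0}" "c \<otimes> u0 = b \<otimes> v"
      by (auto simp: r_coset_eq_image)
    obtain l :: nat where l: "l \<ge> 1" "v = h [^] l \<otimes> u0" using Uu0[OF cv(2)] by blast
    have "c \<otimes> u0 = b \<otimes> h [^] l \<otimes> u0" using cv(3) l(2) cA[OF b(1)] h u0c by (simp add: m_assoc)
    then have "c = b \<otimes> h [^] l" using cA cv(1) b(1) h u0c by simp
    then show False using b(2) l(1) cv(1) by blast
  qed
  have disj': "?X b \<inter> ?X b' = {}"
  proof (rule ccontr)
    assume "?X b \<inter> ?X b' \<noteq> {}"
    then obtain v v' where v: "v \<in> U - {u0}" "v' \<in> U - {u0}" "b \<otimes> v = b' \<otimes> v'" by auto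
    obtain l l' :: nat where l: "v = h [^] l \<otimes> u0" "v' = h [^] l' \<otimes> u0"
      using Uu0[OF v(1)] Uu0[OF v(2)] by blast
    have "a' \<otimes> (h [^] n' \<otimes> h [^] l') \<otimes> u0 = a \<otimes> (h [^] n \<otimes> h [^] l) \<otimes> u0"
      using v(3) l h u0c cA[OF a] cA[OF a'(1)] by (simp add: b_def b'_def m_assoc)
    then have "a' \<otimes> h [^] (n' + l') = a \<otimes> h [^] (n + l)"
      using h u0c cA[OF a] cA[OF a'(1)] by (simp add: nat_pow_mult)
    then have "a' = a \<otimes> h [^] (n + l) \<otimes> inv (h [^] (n' + l'))"
      using h cA[OF a] cA[OF a'(1)] by (intro inv_solve_right[THEN iffD2]) auto
    also have "\<dots> = a \<otimes> h [^] (int (n + l) - int (n' + l'))"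
      using h cA[OF a] by (simp only: int_pow_diff int_pow_int m_assoc nat_pow_closed inv_closed)
    finally show False using a'(2) by blast
  qed
  have cardX: "card (?X b) = card U - 1" if "b \<in> A" for b
  proof -
    have "card (?X b) = card (U - {u0})"
      using cA[OF that] cU by (intro card_image) (auto simp: inj_on_def)
    then show ?thesis using u0 U by simp
  qed
  \<comment> \<open>The disjoint sets A u0, b(U - {u0}) and b'(U - {u0}) give |AU| >= |A| + 2(|U| -
    1), which exceeds |A| + |U| + k once |U| >= k + 3.\<close>
  have "card ((A #> u0) \<union> (?X b \<union> ?X b')) = card (A #> u0) + card (?X b \<union> ?X b')"
    using A U disj[OF n] disj[OF n'] by (intro card_Un_disjoint) (auto intro: finite_r_coset)
  also have "card (?X b \<union> ?X b') = card (?X b) + card (?X b')"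
    using U disj' by (intro card_Un_disjoint) auto
  also have "card (A #> u0) = card A" using card_r_coset A u0c by blast
  finally have "card A + (card U - 1 + (card U - 1)) = card ((A #> u0) \<union> (?X b \<union> ?X b'))"
    using cardX n(1) n'(1) by simp
  also have "\<dots> \<le> card (A <#> U)"
    using A U n(1) n'(1) u0
    by (intro card_mono finite_set_mult) (auto simp: r_coset_eq_image intro: mem_set_mult)
  finally show False using k by linarith
qed

text \<open>Inversion turns AB into B^-1 A^-1, which makes A^-1 the right factor, and it turns right
  cosets of <h> into left cosets.\<close>

lemma small_left_factor_cyclic:
  assumes A: "finite A" "A \<subseteq> carrier G" and B: "finite B" "B \<subseteq> carrier G"
    and AB: "card (A <#> B) \<le> card B + s" and large: "4 * fact s * s * (8 * s + 1) < card B"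
  shows "in_left_coset_of_cyclic G A"
proof -
  have "card (m_inv G ` B <#> m_inv G ` A) = card (A <#> B)"
    using A B by (simp add: set_mult_closed card_inv_image flip: inv_image_set_mult)
  then have "card (m_inv G ` B <#> m_inv G ` A) \<le> card (m_inv G ` B) + s"
    "4 * fact s * s * (8 * s + 1) < card (m_inv G ` B)"
    using AB large by (simp_all only: card_inv_image[OF B(2)])
  then have "\<exists>h\<in>carrier G. \<exists>u\<in>carrier G. \<forall>v\<in>m_inv G ` A. \<exists>i::int. v = h [^] i \<otimes> u"
    using A B by (intro small_right_factor_cyclic) auto
  then obtain h u where hu: "h \<in> carrier G" "u \<in> carrier G"
    "\<forall>v\<in>m_inv G ` A. \<exists>i::int. v = h [^] i \<otimes> u"
    by blast
  have "\<exists>i::int. a = inv u \<otimes> h [^] i" if a: "a \<in> A" for a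
  proof -
    have ac: "a \<in> carrier G" using a A by blast
    obtain i where i: "inv a = h [^] (i::int) \<otimes> u" using hu(3) a by auto
    have "a = inv (h [^] i \<otimes> u)" using ac by (simp flip: i)
    also have "\<dots> = inv u \<otimes> h [^] (- i)" using hu by (simp add: inv_mult_group int_pow_neg)
    finally show ?thesis by (rule exI)
  qed
  then show ?thesis
    unfolding in_left_coset_of_cyclic_iff using hu(1,2) by (intro bexI[of _ h] bexI[of _ "inv u"]) auto
qed

end

text \<open>The size required of the other factor in \<open>small_right_factor_cyclic\<close> when
  the product exceeds that factor by at most \<open>s\<close> elements.\<close>

definition cyclic_factor_bound :: "nat \<Rightarrow> nat" where
  "cyclic_factor_bound s = 4 * fact s * s * (8 * s + 1)"

text \<open>The first summand suits an atom U with at most 192(k + 3) elements, for which |AU|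
  exceeds |A| by at most 192(k + 3) + k; the second is what
  \<open>card_le_of_small_intersections\<close> asks of |A| for n = k + 3.\<close>

definition large_factor_bound :: "nat \<Rightarrow> nat" where
  "large_factor_bound k = cyclic_factor_bound (192 * (k + 3) + k) + 72 * (k + 3)"

lemma (in torsion_free) small_product_imp_in_left_coset_of_cyclic:
  assumes A: "finite A" "A \<subseteq> carrier G" and B: "finite B" "B \<subseteq> carrier G"
    and AB: "card (A <#> B) \<le> card A + card B + k"
    and large: "cyclic_factor_bound (large_factor_bound k + k) + (k + 3) < card B"
  shows "in_left_coset_of_cyclic G A"
proof (cases "card A \<le> large_factor_bound k")
  case True
  then show ?thesis
    using small_left_factor_cyclic[OF A B, of "large_factor_bound k + k"] AB large
    by (simp add: cyclic_factor_bound_def)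
next
  case False
  then have "A \<noteq> {}" by auto
  \<comment> \<open>The atom needs at least k + 3 elements for the final count with two
    cosets.\<close>
  moreover have "k + 3 \<le> card B" "card (A <#> B) \<le> card B + (card A + k)" "(1::nat) \<le> k + 3"
    using large AB by auto
  ultimately obtain U where U: "finite U" "U \<subseteq> carrier G" "k + 3 \<le> card U"
    "card (A <#> U) \<le> card U + (card A + k)"
    "\<And>g. g \<in> carrier G \<Longrightarrow> g \<noteq> \<one> \<Longrightarrow> card (U \<inter> (U #> g)) < k + 3"
    using ex_atom[OF A _ B, of "k + 3" "card A + k"] by blast
  have AU: "card (A <#> U) \<le> card A + card U + k" using U(4) by simp
  have "card U \<le> 192 * (k + 3)"
    using False U(3) by (intro card_le_of_small_intersections[OF A U(1,2) _ AU] less_imp_le[OF U(5)])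
      (auto simp: large_factor_bound_def)
  then have "card (A <#> U) \<le> card A + (192 * (k + 3) + k)" using AU by simp
  moreover have "cyclic_factor_bound (192 * (k + 3) + k) < card A"
    using False by (simp add: large_factor_bound_def)
  ultimately have "\<exists>h\<in>carrier G. \<exists>u\<in>carrier G. \<forall>v\<in>U. \<exists>i::int. v = h [^] i \<otimes> u"
    unfolding cyclic_factor_bound_def by (rule small_right_factor_cyclic[OF A U(1,2)])
  then obtain h u where hu: "h \<in> carrier G" "u \<in> carrier G" "\<forall>v\<in>U. \<exists>i::int. v = h [^] i \<otimes> u"
    by blast
  have "\<exists>g\<in>carrier G. \<forall>a\<in>A. \<exists>i::int. a = g \<otimes> h [^] i"
    using A \<open>A \<noteq> {}\<close> U(1,2) hu(1,2) bspec[OF hu(3)] AU U(3)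
    by (rule right_factor_cyclic_imp_left_factor_cyclic)
  then show ?thesis
    unfolding in_left_coset_of_cyclic_iff using hu(1) by (rule rev_bexI[rotated])
qed

section \<open>Thresholds, and their independence of the type\<close>

lemma torsion_free_group_iff: "torsion_free_group G \<longleftrightarrow> torsion_free G"
  unfolding torsion_free_group_def torsion_free_def torsion_free_axioms_def by blast

lemma ex_product_set_threshold: "\<exists>c. product_set_threshold TYPE('a) k c"
proof (intro exI)
  show "product_set_threshold TYPE('a) k (cyclic_factor_bound (large_factor_bound k + k) + (k + 3))"
    unfolding product_set_threshold_def torsion_free_group_iff
    using torsion_free.small_product_imp_in_left_coset_of_cyclic not_le by blast
qed

text \<open>The subgroup generated by two finite sets is countable, so it has a copy on a subset of
  \<^typ>\<open>nat\<close>.\<close>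
lemma product_set_threshold_nat_imp:
  assumes c: "product_set_threshold TYPE(nat) k c"
  shows "product_set_threshold TYPE('a) k c"
  unfolding product_set_threshold_def
proof (intro allI impI)
  fix G :: "'a monoid" and A B :: "'a set"
  assume tf: "torsion_free_group G" and A: "A \<subseteq> carrier G" "finite A"
    and nc: "\<not> in_left_coset_of_cyclic G A" and B: "B \<subseteq> carrier G" "finite B" "card B > c"
  interpret torsion_free G using tf by (simp add: torsion_free_group_iff)
  \<comment> \<open>Inverses are included so that the union of the powers of \<open>S\<close>, a
    countable union of finite sets, is a subgroup.\<close>
  define S where "S = (A \<union> B) \<union> m_inv G ` (A \<union> B)"
  have S: "finite S" "S \<subseteq> carrier G" "m_inv G ` S \<subseteq> S"
    using A B by (auto simp: S_def)
  define K where "K = (\<Union>n. set_pow G S n)"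
  have K: "subgroup K G" unfolding K_def by (rule subgroup_Union_set_pow[OF S(2,3)])
  have AK: "A \<subseteq> K" "B \<subseteq> K"
    using mem_set_pow_1[OF S(2)] by (auto simp: K_def S_def simp del: set_pow.simps)
  have "countable K"
    unfolding K_def by (intro countable_UN countableI_type countable_finite finite_set_pow S(1))
  then obtain f :: "'a \<Rightarrow> nat" where f: "inj_on f K" by (auto simp: countable_def)
  define G' where "G' = G\<lparr>carrier := K\<rparr>"
  interpret G': group G' unfolding G'_def by (rule subgroup_imp_group[OF K])
  \<comment> \<open>Injectivity of \<open>f\<close> says that it is a weak morphism with trivial
    kernel, so the group structure can be transported to its image.\<close>
  have weak: "weak_group_morphism f {\<one>\<^bsub>G'\<^esub>} G'"
  proof (rule weak_group_morphismsI[OF G'.one_is_normal])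
    fix a b assume ab: "a \<in> carrier G'" "b \<in> carrier G'"
    then have "f a = f b \<longleftrightarrow> a = b" using f by (auto simp: G'_def inj_on_eq_iff)
    also have "\<dots> \<longleftrightarrow> a \<otimes>\<^bsub>G'\<^esub> inv\<^bsub>G'\<^esub> b \<in> {\<one>\<^bsub>G'\<^esub>}" using ab by (simp add: G'.inv_solve_right')
    finally show "f a = f b \<longleftrightarrow> a \<otimes>\<^bsub>G'\<^esub> inv\<^bsub>G'\<^esub> b \<in> {\<one>\<^bsub>G'\<^esub>}" .
  qed
  define N where "N = image_group f G'"
  interpret N: group N unfolding N_def by (rule G'.image_group_is_group[OF weak])
  have cN: "carrier N = f ` K" by (simp add: N_def image_group_carrier G'_def)
  have homf: "f \<in> hom G' N" unfolding N_def by (rule G'.weak_group_morphism_is_hom[OF weak])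
  \<comment> \<open>The inverse of \<open>f\<close> embeds the copy \<open>N\<close> into
    \<open>G\<close>; through it the hypotheses on \<open>G\<close> and \<open>A\<close> pass to
    \<open>N\<close>.\<close>
  define p where "p = inv_into K f"
  have "f \<in> iso G' N" using homf f cN by (auto simp: iso_def bij_betw_def G'_def)
  then have "p \<in> iso N G'"
    using G'.iso_set_sym[of f N] by (simp add: p_def G'_def)
  then have homp: "p \<in> hom N G" "inj_on p (carrier N)"
    using subgroup.subset[OF K] by (auto simp: iso_def hom_def G'_def bij_betw_def)
  interpret p: group_hom N G p using homp(1) by unfold_locales
  have "torsion_free_group N"
    unfolding torsion_free_group_def
  proof (intro conjI ballI allI impI)
    fix x :: nat and n :: nat
    assume x: "x \<in> carrier N" and n: "1 \<le> n" "x [^]\<^bsub>N\<^esub> n = \<one>\<^bsub>N\<^esub>"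
    have "p x [^]\<^bsub>G\<^esub> n = \<one>\<^bsub>G\<^esub>" using p.hom_nat_pow[OF x, of n] n(2) by simp
    then have "p x = p \<one>\<^bsub>N\<^esub>" using torsion_free[of "p x" n] x n(1) by simp
    then show "x = \<one>\<^bsub>N\<^esub>" using homp(2) x by (auto simp: inj_on_def)
  qed (rule N.group_axioms)
  moreover have "\<not> in_left_coset_of_cyclic N (f ` A)"
  proof
    assume "in_left_coset_of_cyclic N (f ` A)"
    then have "in_left_coset_of_cyclic G (p ` f ` A)"
      by (rule N.in_left_coset_of_cyclic_hom_image[OF group_axioms homp(1)])
    then show False using nc AK f by (simp add: p_def)
  qed
  moreover have cardf: "card (f ` X) = card X" if "X \<subseteq> K" for X
    using inj_on_subset[OF f that] by (rule card_image)
  ultimately have "card (f ` A) + card (f ` B) + k < card (f ` A <#>\<^bsub>N\<^esub> f ` B)"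
    using c A(2) B AK unfolding product_set_threshold_def by (metis cN finite_imageI image_mono)
  moreover have "f ` A <#>\<^bsub>N\<^esub> f ` B = f ` (A <#>\<^bsub>G\<^esub> B)"
  proof -
    have "f ` a <#>\<^bsub>N\<^esub> f ` b = f ` (a <#>\<^bsub>G'\<^esub> b)" if "a \<subseteq> carrier G'" "b \<subseteq> carrier G'" for a b
      using set_mult_hom[OF homf that] by simp
    then show ?thesis using AK by (simp add: G'_def set_mult_def)
  qed
  moreover have "A <#>\<^bsub>G\<^esub> B \<subseteq> K"
    using AK subgroup.m_closed[OF K] by (auto simp: set_mult_def)
  ultimately show "card A + card B + k < card (A <#>\<^bsub>G\<^esub> B)"
    using cardf AK by simp
qed

theorem theorem2:
  fixes k :: nat
  assumes "k \<ge> 1"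
  shows "(\<exists>c. product_set_threshold TYPE('a) k c) \<and>
         (\<forall>c. product_set_threshold TYPE(nat) k c \<longrightarrow> product_set_threshold TYPE('a) k c)"
  using ex_product_set_threshold product_set_threshold_nat_imp by blast

end
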